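(* Let $2\le\tau\le\sigma$ be integers, let $f$ be a $(\tau,\sigma)$-polynomial cost function, let $\alpha\ge\alpha_\star^{(\tau)}:=\tau^{\tau/(\tau-1)}$, $\rho>0$, $b=\min\{\rho,1\}$, and consider the system for $\phi:[0,b]\to[0,\infty)$: $$\phi'(y)=\alpha\cdot\frac{f'(\phi(y))-f'(y)}{\min\{\phi(y),1\}\,f''(\phi(y))},\quad\phi'(y)\ge0,\quad\phi(y)\ge y\quad(0<y\le b),\qquad\phi(0)=0,\ \ \phi(b)\ge\rho.\tag{LS}$$ Let $P(\alpha)$ be the maximal utilization level. Then: Case I: if $\rho>P(\alpha)$, (LS) has no solution, i.e. there is no $\alpha$-competitive reserve function. Case II: if $\rho=P(\alpha)$, (LS) has a unique solution, namely the one extended from the upper-bound solution of the unlimited-supply equation. Case III: if $\rho<P(\alpha)$, (LS) has infinitely many solutions.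
   Context: A $(\tau,\sigma)$-polynomial is $f(y)=\sum_{k=\tau}^{\sigma}c_ky^k$ with $c_k\ge0$, $c_\tau,c_\sigma>0$. (LS) characterizes $\alpha$-competitive reserve functions for single-node online allocation with cost $f$, total supply limit $1$ and maximum request value $v_{\max}=f'(\rho)$. Let $\chi^{(\tau)}_+$ be the larger positive root of $z^\tau-\frac{\alpha}{\tau-1}(z^{\tau-1}-1)$ (it exists as $\alpha\ge\alpha_\star^{(\tau)}$). Upper-bound solution of the unlimited-supply equation with parameter $\alpha$: $\phi_{\mathrm{ub}}(y)$ is the supremum of $\phi(y)$ over all functions $\phi$ that on $[0,y]$ are continuous with $\phi(0)=0$, $\phi'(0)=\chi^{(\tau)}_+$, $\phi(u)\ge u$ and $\phi'(u)=\alpha\frac{f'(\phi(u))-f'(u)}{\phi(u)f''(\phi(u))}$ for $0<u\le y$; it is considered on the (possibly bounded) interval of those $y$ for which such $\phi$ exist. Extension: if $\phi_{\mathrm{ub}}$ never exceeds $1$, put $\tilde\phi_{\mathrm{ub}}=\phi_{\mathrm{ub}}$. Otherwise let $y^*$ be the point with $\phi_{\mathrm{ub}}(y^* )=1$ and let $\tilde\phi_{\mathrm{ub}}$ equal $\phi_{\mathrm{ub}}$ on $[0,y^*]$ and, for $y\ge y^*$, the solution of $\phi'=\alpha\frac{f'(\phi)-f'(y)}{\min\{\phi,1\}f''(\phi)}$ with $\phi(y^* )=1$. The function $\tilde\phi_{\mathrm{ub}}=\tilde\phi_{\mathrm{ub}}(\cdot,\alpha)$ is the upper-bound solution for the limited-supply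 equation. The maximal utilization level is $P(\alpha)=\sup_y\tilde\phi_{\mathrm{ub}}(y,\alpha)$, the supremum being over those $y\in[0,1]$ at which $\tilde\phi_{\mathrm{ub}}$ is defined. *)

theory Defs
  imports "HOL-Analysis.Analysis" "HOL-Computational_Algebra.Polynomial"
begin

definition cost_polynomial :: "nat \<Rightarrow> nat \<Rightarrow> real poly \<Rightarrow> bool" where
  "cost_polynomial \<tau> \<sigma> f \<longleftrightarrow>
     (\<exists>c. f = (\<Sum>k=\<tau>..\<sigma>. monom (c k) k) \<and> (\<forall>k\<in>{\<tau>..\<sigma>}. 0 \<le> c k) \<and> 0 < c \<tau> \<and> 0 < c \<sigma>)"

definition alpha_star :: "nat \<Rightarrow> real" where
  "alpha_star \<tau> = real \<tau> powr (real \<tau> / (real \<tau> - 1))"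

(* At the threshold value of alpha the two positive roots coincide; Max then returns the double root. *)
definition chi_plus :: "nat \<Rightarrow> real \<Rightarrow> real" where
  "chi_plus \<tau> \<alpha> = Max {z. 0 < z \<and> z ^ \<tau> - \<alpha> / (real \<tau> - 1) * (z ^ (\<tau> - 1) - 1) = 0}"

definition unlimited_rhs :: "real poly \<Rightarrow> real \<Rightarrow> real \<Rightarrow> real \<Rightarrow> real" where
  "unlimited_rhs f \<alpha> y v =
     \<alpha> * ((poly (pderiv f) v - poly (pderiv f) y) / (v * poly (pderiv (pderiv f)) v))"

definition limited_rhs :: "real poly \<Rightarrow> real \<Rightarrow> real \<Rightarrow> real \<Rightarrow> real" where
  "limited_rhs f \<alpha> y v =
     \<alpha> * ((poly (pderiv f) v - poly (pderiv f) y) / (min v 1 * poly (pderiv (pderiv f)) v))"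

(* All derivatives are taken within the closed interval of definition, hence one-sided at its end
   points. For y = 0 the derivative condition at 0 is vacuous, so 0 is always in ub_domain. *)
definition ub_admissible :: "real poly \<Rightarrow> nat \<Rightarrow> real \<Rightarrow> real \<Rightarrow> (real \<Rightarrow> real) \<Rightarrow> bool" where
  "ub_admissible f \<tau> \<alpha> y \<phi> \<longleftrightarrow>
     continuous_on {0..y} \<phi> \<and> \<phi> 0 = 0 \<and>
     (\<phi> has_real_derivative chi_plus \<tau> \<alpha>) (at 0 within {0..y}) \<and>
     (\<forall>u\<in>{0<..y}. u \<le> \<phi> u \<and>
        (\<phi> has_real_derivative unlimited_rhs f \<alpha> u (\<phi> u)) (at u within {0..y}))"

definition ub_domain :: "real poly \<Rightarrow> nat \<Rightarrow> real \<Rightarrow> real set" where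
  "ub_domain f \<tau> \<alpha> = {y. 0 \<le> y \<and> (\<exists>\<phi>. ub_admissible f \<tau> \<alpha> y \<phi>)}"

(* phi_ub is meaningful on ub_domain only; there the set of values is bounded above by
   alpha * y / (tau - 1), because v * f''(v) >= (tau - 1) * f'(v). *)
definition phi_ub :: "real poly \<Rightarrow> nat \<Rightarrow> real \<Rightarrow> real \<Rightarrow> real" where
  "phi_ub f \<tau> \<alpha> y = (SUP \<phi>\<in>{\<phi>. ub_admissible f \<tau> \<alpha> y \<phi>}. \<phi> y)"

definition ub_exceeds_1 :: "real poly \<Rightarrow> nat \<Rightarrow> real \<Rightarrow> bool" where
  "ub_exceeds_1 f \<tau> \<alpha> \<longleftrightarrow> (\<exists>y\<in>ub_domain f \<tau> \<alpha>. 1 < phi_ub f \<tau> \<alpha> y)"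

definition y_star :: "real poly \<Rightarrow> nat \<Rightarrow> real \<Rightarrow> real" where
  "y_star f \<tau> \<alpha> = (THE y. y \<in> ub_domain f \<tau> \<alpha> \<and> phi_ub f \<tau> \<alpha> y = 1)"

(* Positivity of phi keeps the denominator of the right-hand side nonzero (division by zero is total
   in HOL). It can only matter for y > 1, since the solution is at least 1 up to y = 1. *)
definition continuation :: "real poly \<Rightarrow> real \<Rightarrow> real \<Rightarrow> real \<Rightarrow> (real \<Rightarrow> real) \<Rightarrow> bool" where
  "continuation f \<alpha> s y \<phi> \<longleftrightarrow>
     s \<le> y \<and> \<phi> s = 1 \<and>
     (\<forall>u\<in>{s..y}. 0 < \<phi> u \<and>
        (\<phi> has_real_derivative limited_rhs f \<alpha> u (\<phi> u)) (at u within {s..y}))"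

definition phi_ext_domain :: "real poly \<Rightarrow> nat \<Rightarrow> real \<Rightarrow> real set" where
  "phi_ext_domain f \<tau> \<alpha> =
     (if ub_exceeds_1 f \<tau> \<alpha>
      then {0..y_star f \<tau> \<alpha>} \<union> {y. \<exists>\<phi>. continuation f \<alpha> (y_star f \<tau> \<alpha>) y \<phi>}
      else ub_domain f \<tau> \<alpha>)"

definition phi_ext :: "real poly \<Rightarrow> nat \<Rightarrow> real \<Rightarrow> real \<Rightarrow> real" where
  "phi_ext f \<tau> \<alpha> y =
     (if ub_exceeds_1 f \<tau> \<alpha> \<and> y_star f \<tau> \<alpha> < y
      then THE v. \<exists>\<phi>. continuation f \<alpha> (y_star f \<tau> \<alpha>) y \<phi> \<and> \<phi> y = v
      else phi_ub f \<tau> \<alpha> y)"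

definition max_utilization :: "real poly \<Rightarrow> nat \<Rightarrow> real \<Rightarrow> real" where
  "max_utilization f \<tau> \<alpha> = (SUP y\<in>{0..1} \<inter> phi_ext_domain f \<tau> \<alpha>. phi_ext f \<tau> \<alpha> y)"

(* Solutions are functions on [0, b], made extensional so that counting them counts functions on
   [0, b]. Continuity on the closed interval gives the condition phi 0 = 0 its meaning as an initial
   condition, the equation itself being imposed only for y > 0. *)
definition LS_solutions :: "real poly \<Rightarrow> real \<Rightarrow> real \<Rightarrow> (real \<Rightarrow> real) set" where
  "LS_solutions f \<alpha> \<rho> =
     (let b = min \<rho> 1 in
      {\<phi> \<in> {0..b} \<rightarrow>\<^sub>E {0..}.
         continuous_on {0..b} \<phi> \<and> \<phi> 0 = 0 \<and> \<rho> \<le> \<phi> b \<and>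
         (\<forall>y\<in>{0<..b}. y \<le> \<phi> y \<and>
            (\<exists>D. (\<phi> has_real_derivative D) (at y within {0..b}) \<and>
                 D = limited_rhs f \<alpha> y (\<phi> y) \<and> 0 \<le> D))})"

end

theory Submission
  imports Defs
begin

text \<open>
  Both equations have a right-hand side that is Lipschitz in \<open>\<phi>\<close> on \<open>\<phi> \<ge> y\<close>, locally uniformly
  in \<open>y > 0\<close>; clamping it at the diagonal \<open>\<phi> = y\<close> gives an equation whose solutions exist on
  \<open>(0, \<infinity>)\<close>, never cross each other, and are constant once they fall below the diagonal. Near
  \<open>0\<close> the line \<open>\<chi> y\<close> of slope \<open>\<chi> = chi_plus \<tau> \<alpha>\<close> is a supersolution that dominates every
  solution starting at \<open>0\<close>, and the parabola \<open>\<chi> y - K y\<^sup>2\<close> is a subsolution for large \<open>K\<close>, also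
  when \<open>\<chi>\<close> is a double root. The largest clamped solution \<open>\<Phi>\<close> that starts below the line is thus
  squeezed between the two. It has slope \<open>\<chi>\<close> at \<open>0\<close>, dominates all solutions, and is the
  upper-bound solution.
  A clamped solution below \<open>\<Phi>\<close> that ends on or above the diagonal solves the
  original problem, so the end values of the solutions fill an interval with upper end \<open>\<Phi> b\<close>.
\<close>

section \<open>Scalar differential equations\<close>

text \<open>At \<open>0\<close> the right-hand side has the form 0/0 and the initial value does not
  single out a solution. Solutions are therefore labelled by their value at a positive point, from
  which they are determined backwards as well as forwards. For values at most 1 the leading term of
  degree tau makes the field depend, to first order at \<open>0\<close>, only on the ratio z = v/u.
  This limit is \<open>slope_map\<close>, and its positive fixed points are the roots of
  \<open>char_poly\<close>. The delicate case is a double root: there \<open>slope_map\<close> is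
  tangent to the identity, so its linearisation gives no contraction. The parabola still works
  because its derivative falls short of chi by 2 K u, while the ratio v/u falls short of it by K u
  only. The difference pays for the terms of higher degree. The two equations share one development
  because they coincide for values at most 1, so all estimates near \<open>0\<close> are the
  same.\<close>

lemma diff_ineq_forward:
  fixes D D' :: "real \<Rightarrow> real"
  assumes der: "\<And>t. t \<in> {a..b} \<Longrightarrow> (D has_real_derivative D' t) (at t within {a..b})"
    and le: "\<And>t. t \<in> {a..b} \<Longrightarrow> 0 < D t \<Longrightarrow> D' t \<le> L * D t"
    and init: "D a \<le> 0" and t: "t \<in> {a..b}"
  shows "D t \<le> 0"
proof (rule ccontr)
  assume "\<not> D t \<le> 0"
  then have Dt: "0 < D t" by simp
  have contD: "continuous_on {a..b} D"
    by (rule DERIV_continuous_on) (rule der)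
  \<comment> \<open>Gronwall is applied only after the last time \<open>s\<close> with
    \<open>D s\<close> nonpositive: from there on \<open>D\<close> is positive, so the hypothesis on
    \<open>D'\<close> is available and \<open>exp (- L * r) * D r\<close> is nonincreasing.\<close>
  define S where "S = {s \<in> {a..t}. D s \<le> 0}"
  have "continuous_on {a..t} D" by (rule continuous_on_subset[OF contD]) (use t in auto)
  then have "closed ({a..t} \<inter> D -` {..0})" by (intro continuous_closed_preimage) auto
  moreover have "{a..t} \<inter> D -` {..0} = S" by (auto simp: S_def)
  ultimately have "closed S" by simp
  moreover have "bounded S"
    by (rule bounded_subset[of "{a..t}"]) (auto simp: S_def)
  ultimately have cS: "compact S" by (simp add: compact_eq_bounded_closed)
  have "a \<in> S" using init t by (auto simp: S_def)
  then obtain s where s: "s \<in> S" and s_max: "\<And>r. r \<in> S \<Longrightarrow> r \<le> s"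
    using compact_attains_sup[OF cS] by blast
  have s_le: "a \<le> s" "s \<le> t" "D s \<le> 0" using s by (auto simp: S_def)
  have pos: "0 < D r" if "s < r" "r \<le> t" for r
    using s_max[of r] that s_le by (force simp: S_def)
  define E where "E r = exp (- L * r) * D r" for r
  have "E t \<le> E s"
  proof (rule DERIV_nonpos_imp_decreasing_open[where f = E])
    show "s \<le> t" by fact
    show "continuous_on {s..t} E" unfolding E_def
      by (intro continuous_intros continuous_on_subset[OF contD]) (use t s_le in auto)
    fix r assume r: "s < r" "r < t"
    then have rab: "r \<in> {a..b}" "a < r" "r < b" using t s_le by auto
    have "(D has_real_derivative D' r) (at r)"
      using der[OF rab(1)] rab by (simp add: at_within_Icc_at)
    then have "(E has_real_derivative exp (- L * r) * (D' r - L * D r)) (at r)"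
      unfolding E_def by (auto intro!: derivative_eq_intros simp: algebra_simps)
    moreover have "exp (- L * r) * (D' r - L * D r) \<le> 0"
      using le[OF rab(1) pos] r by (intro mult_nonneg_nonpos) auto
    ultimately show "\<exists>y. (E has_real_derivative y) (at r) \<and> y \<le> 0" by blast
  qed
  moreover have "E s \<le> 0" using s_le by (auto simp: E_def mult_nonneg_nonpos)
  moreover have "0 < E t" using Dt by (simp add: E_def)
  ultimately show False by simp
qed

lemma DERIV_reflect_within:
  fixes D :: "real \<Rightarrow> real"
  assumes "(D has_real_derivative d) (at (- t) within {- b..- a})"
  shows "((\<lambda>s. D (- s)) has_real_derivative - d) (at t within {a..b})"
proof -
  have "(D has_real_derivative d) (at (- t) within uminus ` {a..b})"
    using assms by (simp add: image_uminus_atLeastAtMost)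
  from DERIV_image_chain[OF this DERIV_minus[OF DERIV_ident]]
  show ?thesis by (simp add: o_def)
qed

lemma diff_ineq_backward:
  fixes D D' :: "real \<Rightarrow> real"
  assumes der: "\<And>t. t \<in> {a..b} \<Longrightarrow> (D has_real_derivative D' t) (at t within {a..b})"
    and le: "\<And>t. t \<in> {a..b} \<Longrightarrow> 0 < D t \<Longrightarrow> - L * D t \<le> D' t"
    and init: "D b \<le> 0" and t: "t \<in> {a..b}"
  shows "D t \<le> 0"
proof -
  have "D (- (- t)) \<le> 0"
  proof (rule diff_ineq_forward[where a = "- b" and b = "- a" and t = "- t"
        and D = "\<lambda>s. D (- s)" and D' = "\<lambda>s. - D' (- s)" and L = L])
    fix s assume s: "s \<in> {- b..- a}"
    show "((\<lambda>s. D (- s)) has_real_derivative - D' (- s)) (at s within {- b..- a})"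
      by (rule DERIV_reflect_within) (use der[of "- s"] s in auto)
    assume "0 < D (- s)"
    then show "- D' (- s) \<le> L * D (- s)" using le[of "- s"] s by auto
  qed (use init t in auto)
  then show ?thesis by simp
qed

section \<open>Existence of solutions on compact intervals\<close>

lemma picard_forward:
  fixes G :: "real \<Rightarrow> real \<Rightarrow> real"
  assumes ab: "a \<le> b"
    and G: "continuous_on ({a..b} \<times> UNIV) (\<lambda>(s, v). G s v)"
    and lip: "\<And>s v w. s \<in> {a..b} \<Longrightarrow> \<bar>G s v - G s w\<bar> \<le> L * \<bar>v - w\<bar>"
  obtains x where "x a = v"
    "\<And>t. t \<in> {a..b} \<Longrightarrow> (x has_real_derivative G t (x t)) (at t within {a..b})"
proof -
  have cont: "continuous_on {a..b} (\<lambda>s. G s (x s))" if "continuous_on {a..b} x" for x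
  proof -
    have "continuous_on {a..b} (\<lambda>s. (s, x s))" by (intro continuous_intros that)
    then show ?thesis
      using continuous_on_compose2[OF G, of "{a..b}" "\<lambda>s. (s, x s)"] by auto
  qed
  define M where "M = max L 1"
  have M: "0 < M" "L \<le> M" by (auto simp: M_def)
  \<comment> \<open>Exponential weight: the iteration acts on \<open>x / E\<close>. As
    \<open>M * d * E\<close> integrates to at most \<open>d/2 * E\<close>, the Picard map contracts
    by 1/2 on all of \<open>{a..b}\<close>, however long the interval is.\<close>
  define E where "E s = exp (2 * M * (s - a))" for s
  have Epos: "0 < E s" for s by (simp add: E_def)
  define N where "N y s = G s (E s * y s)" for y s
  \<comment> \<open>Projecting time onto \<open>{a..b}\<close> extends every iterate to a bounded
    continuous function on the real line, so that Banach's theorem applies in the complete type of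
    such functions.\<close>
  define c where "c t = max a (min t b)" for t
  have c: "c t \<in> {a..b}" for t using ab by (auto simp: c_def)
  have contE: "continuous_on A E" for A unfolding E_def by (intro continuous_intros)
  have contN: "continuous_on {a..b} (N y)" if "continuous_on {a..b} y" for y
    unfolding N_def by (intro cont continuous_intros contE that)
  define S where "S y t = (v + integral {a..c t} (N y)) / E (c t)" for y t
  have contS: "continuous_on UNIV (S y)" and rangeS: "bounded (range (S y))"
    if y: "continuous_on {a..b} y" for y
  proof -
    have I: "continuous_on {a..b} (\<lambda>t. integral {a..t} (N y))"
      by (intro indefinite_integral_continuous_1 integrable_continuous_real contN y)
    define J where "J t = (v + integral {a..t} (N y)) / E t" for t
    have J: "continuous_on {a..b} J" unfolding J_def
      by (intro continuous_intros I contE) (simp add: Epos less_imp_neq[symmetric])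
    have eq: "S y = J \<circ> c" by (auto simp: S_def J_def)
    have cc: "continuous_on UNIV c" unfolding c_def by (intro continuous_intros)
    show "continuous_on UNIV (S y)" unfolding eq
      by (rule continuous_on_compose[OF cc]) (rule continuous_on_subset[OF J], use c in auto)
    have "compact (J ` {a..b})" by (intro compact_continuous_image J) auto
    then have "bounded (J ` {a..b})" by (rule compact_imp_bounded)
    then show "bounded (range (S y))"
      by (rule bounded_subset) (use c in \<open>auto simp: eq\<close>)
  qed
  define T where "T = (\<lambda>y :: real \<Rightarrow>\<^sub>C real. Bcontfun (S (apply_bcontfun y)))"
  have T: "apply_bcontfun (T y) = S (apply_bcontfun y)" for y
    unfolding T_def by (rule Bcontfun_inverse) (auto simp: bcontfun_def contS rangeS)
  have contr: "dist (T y) (T z) \<le> 1/2 * dist y z" for y z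
  proof (rule dist_bound)
    fix t
    define d where "d = dist y z"
    have yz: "\<bar>apply_bcontfun y s - apply_bcontfun z s\<bar> \<le> d" for s
      using dist_bounded[of y s z] by (simp add: d_def dist_real_def)
    have sub: "{a..c t} \<subseteq> {a..b}" using c[of t] by auto
    have int: "N (apply_bcontfun u) integrable_on {a..c t}" for u :: "real \<Rightarrow>\<^sub>C real"
      by (intro integrable_continuous_real continuous_on_subset[OF contN sub]) auto
    have intE: "((\<lambda>s. M * d * E s) has_integral (d/2 * E (c t) - d/2 * E a)) {a..c t}"
    proof (rule fundamental_theorem_of_calculus)
      show "a \<le> c t" using c[of t] by auto
      fix s
      have "((\<lambda>s. d/2 * E s) has_real_derivative M * d * E s) (at s within {a..c t})"
        unfolding E_def by (auto intro!: derivative_eq_intros)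
      then show "((\<lambda>s. d/2 * E s) has_vector_derivative M * d * E s) (at s within {a..c t})"
        by (simp add: has_real_derivative_iff_has_vector_derivative)
    qed
    have "\<bar>integral {a..c t} (\<lambda>s. N (apply_bcontfun y) s - N (apply_bcontfun z) s)\<bar>
        \<le> integral {a..c t} (\<lambda>s. M * d * E s)"

      unfolding real_norm_def[symmetric]
    proof (rule integral_norm_bound_integral)
      fix s assume "s \<in> {a..c t}"
      then have s: "s \<in> {a..b}" using sub by auto
      have "\<bar>N (apply_bcontfun y) s - N (apply_bcontfun z) s\<bar>
          \<le> L * \<bar>E s * apply_bcontfun y s - E s * apply_bcontfun z s\<bar>"
        unfolding N_def by (rule lip[OF s])
      also have "\<dots> \<le> M * \<bar>E s * apply_bcontfun y s - E s * apply_bcontfun z s\<bar>"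
        using M by (intro mult_right_mono) auto
      also have "\<bar>E s * apply_bcontfun y s - E s * apply_bcontfun z s\<bar>
          = E s * \<bar>apply_bcontfun y s - apply_bcontfun z s\<bar>"
        using Epos[of s] by (simp add: abs_mult right_diff_distrib[symmetric])
      also have "M * (E s * \<bar>apply_bcontfun y s - apply_bcontfun z s\<bar>) \<le> M * (E s * d)"
        using M Epos[of s] yz[of s] by (intro mult_left_mono) auto
      finally show "norm (N (apply_bcontfun y) s - N (apply_bcontfun z) s) \<le> M * d * E s"
        by (simp add: mult_ac)
    qed (use intE int in \<open>auto intro!: integrable_diff simp: has_integral_integrable\<close>)
    also have "\<dots> = d/2 * E (c t) - d/2 * E a" using intE by (rule integral_unique)
    also have "\<dots> \<le> d/2 * E (c t)" using Epos[of a] by (simp add: d_def)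
    finally have "\<bar>integral {a..c t} (N (apply_bcontfun y)) - integral {a..c t} (N (apply_bcontfun z))\<bar>
        \<le> d/2 * E (c t)"
      by (simp add: integral_diff int)
    then show "dist (apply_bcontfun (T y) t) (apply_bcontfun (T z) t) \<le> 1/2 * dist y z"
      using Epos[of "c t"]
      by (simp add: T S_def dist_real_def diff_divide_distrib[symmetric] divide_le_eq d_def)
  qed
  obtain y where y: "T y = y"
    using banach_fix_type[of "1/2" T] contr by auto
  define x where "x t = E t * apply_bcontfun y t" for t
  have x_eq: "x t = v + integral {a..t} (\<lambda>s. G s (x s))" if "t \<in> {a..b}" for t
  proof -
    have "c t = t" using that by (auto simp: c_def)
    then have "apply_bcontfun y t = (v + integral {a..t} (N (apply_bcontfun y))) / E t"
      using T[of y] y by (metis S_def)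
    then show ?thesis using Epos[of t] by (simp add: x_def N_def[abs_def])
  qed
  have contx: "continuous_on {a..b} x" unfolding x_def by (intro continuous_intros contE) auto
  show ?thesis
  proof
    show "x a = v" using x_eq[of a] ab by simp
    fix t assume t: "t \<in> {a..b}"
    have "((\<lambda>t. integral {a..t} (\<lambda>s. G s (x s))) has_real_derivative G t (x t)) (at t within {a..b})"
      by (rule integral_has_real_derivative[OF cont[OF contx] t])
    from DERIV_add[OF DERIV_const[of v] this]
    have "((\<lambda>t. v + integral {a..t} (\<lambda>s. G s (x s))) has_real_derivative G t (x t)) (at t within {a..b})"
      by simp
    then show "(x has_real_derivative G t (x t)) (at t within {a..b})"
      by (rule has_field_derivative_transform_within[of _ _ _ _ 1]) (use t x_eq in auto)
  qed
qed

lemma DERIV_within_Icc_join: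
  fixes x :: "real \<Rightarrow> real"
  assumes "(x has_real_derivative d) (at y within {a..y})"
    and "(x has_real_derivative d) (at y within {y..b})" and "a \<le> y" "y \<le> b"
  shows "(x has_real_derivative d) (at y within {a..b})"
proof -
  have "{a..b} = {a..y} \<union> {y..b}" using assms by auto
  then show ?thesis
    using assms by (simp add: has_field_derivative_iff Lim_within_Un)
qed

lemma picard:
  fixes G :: "real \<Rightarrow> real \<Rightarrow> real"
  assumes y: "a < y" "y < b"
    and G: "continuous_on ({a..b} \<times> UNIV) (\<lambda>(s, v). G s v)"
    and lip: "\<And>s v w. s \<in> {a..b} \<Longrightarrow> \<bar>G s v - G s w\<bar> \<le> L * \<bar>v - w\<bar>"
  obtains x where "x y = v"
    "\<And>t. t \<in> {a..b} \<Longrightarrow> (x has_real_derivative G t (x t)) (at t within {a..b})"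
proof -
  have "continuous_on ({y..b} \<times> UNIV) (\<lambda>(s, v). G s v)"
    by (rule continuous_on_subset[OF G]) (use y in auto)
  then obtain r where r: "r y = v"
    "\<And>t. t \<in> {y..b} \<Longrightarrow> (r has_real_derivative G t (r t)) (at t within {y..b})"
    using picard_forward[of y b G L v] lip y by auto
  have Gm: "continuous_on ({- y..- a} \<times> UNIV) (\<lambda>(s, v). - G (- s) v)"
  proof -
    have "continuous_on ({- y..- a} \<times> UNIV) (\<lambda>p. (- fst p, snd p) :: real \<times> real)"
      by (intro continuous_intros)
    from continuous_on_minus[OF continuous_on_compose2[OF G this]] show ?thesis
      using y by (force simp: case_prod_beta)
  qed
  have lipm: "\<bar>- G (- s) u - - G (- s) w\<bar> \<le> L * \<bar>u - w\<bar>" if "s \<in> {- y..- a}" for s u w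
    using lip[of "- s" u w] that y by (auto simp: abs_minus_commute)
  obtain l where l: "l (- y) = v"
    "\<And>t. t \<in> {- y..- a} \<Longrightarrow> (l has_real_derivative - G (- t) (l t)) (at t within {- y..- a})"
    by (rule picard_forward[OF _ Gm lipm, of v]) (use y in auto)
  have l': "((\<lambda>s. l (- s)) has_real_derivative G t (l (- t))) (at t within {a..y})"
    if "t \<in> {a..y}" for t
    using DERIV_reflect_within[of l _ t y a] l(2)[of "- t"] that by force
  define x where "x t = (if t \<le> y then l (- t) else r t)" for t
  have xl: "(x has_real_derivative G t (x t)) (at t within {a..y})" if "t \<in> {a..y}" for t
    by (rule has_field_derivative_transform_within[of "\<lambda>s. l (- s)" _ _ _ 1])
      (use l'[OF that] that in \<open>auto simp: x_def\<close>)
  have xr: "(x has_real_derivative G t (x t)) (at t within {y..b})" if "t \<in> {y..b}" for t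
    by (rule has_field_derivative_transform_within[of r _ _ _ 1])
      (use r l(1) that in \<open>auto simp: x_def\<close>)
  show ?thesis
  proof
    show "x y = v" using l by (simp add: x_def)
    fix t assume t: "t \<in> {a..b}"
    consider "t < y" | "t = y" | "y < t" by linarith
    then show "(x has_real_derivative G t (x t)) (at t within {a..b})"
    proof cases
      case 1
      have "at t within {a..b} = at t within {a..y}"
        by (rule at_within_nhd[of _ "{..<y}"]) (use 1 y in auto)
      then show ?thesis using xl[of t] 1 t by auto
    next
      case 2
      then show ?thesis using xl[of y] xr[of y] y by (auto intro: DERIV_within_Icc_join)
    next
      case 3
      have "at t within {a..b} = at t within {y..b}"
        by (rule at_within_nhd[of _ "{y<..}"]) (use 3 y in auto)
      then show ?thesis using xr[of t] 3 t by auto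
    qed
  qed
qed

section \<open>Comparison and global existence for fields that are Lipschitz away from time
  zero\<close>

locale lipschitz_field =
  fixes H :: "real \<Rightarrow> real \<Rightarrow> real"
  assumes field_continuous: "0 < a \<Longrightarrow> continuous_on ({a..b} \<times> UNIV) (\<lambda>(s, v). H s v)"
    and field_lipschitz: "0 < a \<Longrightarrow> \<exists>L. \<forall>s\<in>{a..b}. \<forall>v w. \<bar>H s v - H s w\<bar> \<le> L * \<bar>v - w\<bar>"
begin

lemma compare_forward:
  assumes "0 < a"
    and x: "\<And>t. t \<in> {a..b} \<Longrightarrow> (x has_real_derivative dx t) (at t within {a..b})"
    and z: "\<And>t. t \<in> {a..b} \<Longrightarrow> (z has_real_derivative dz t) (at t within {a..b})"
    and dx: "\<And>t. t \<in> {a..b} \<Longrightarrow> dx t \<le> H t (x t)"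
    and dz: "\<And>t. t \<in> {a..b} \<Longrightarrow> H t (z t) \<le> dz t"
    and init: "x a \<le> z a" and t: "t \<in> {a..b}"
  shows "x t \<le> z t"
proof -
  obtain L where L: "\<And>s v w. s \<in> {a..b} \<Longrightarrow> \<bar>H s v - H s w\<bar> \<le> L * \<bar>v - w\<bar>"
    using field_lipschitz[OF \<open>0 < a\<close>] by blast
  have "x t - z t \<le> 0"
  proof (rule diff_ineq_forward[where D = "\<lambda>t. x t - z t" and D' = "\<lambda>t. dx t - dz t" and a = a and b = b and L = L])
    fix s assume s: "s \<in> {a..b}"
    show "((\<lambda>t. x t - z t) has_real_derivative dx s - dz s) (at s within {a..b})"
      by (intro derivative_intros x z s)
    assume "0 < x s - z s"
    then show "dx s - dz s \<le> L * (x s - z s)"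
      using L[OF s, of "x s" "z s"] dx[OF s] dz[OF s] by auto
  qed (use init t in auto)
  then show ?thesis by simp
qed

lemma compare_backward:
  assumes "0 < a"
    and x: "\<And>t. t \<in> {a..b} \<Longrightarrow> (x has_real_derivative dx t) (at t within {a..b})"
    and z: "\<And>t. t \<in> {a..b} \<Longrightarrow> (z has_real_derivative dz t) (at t within {a..b})"
    and dx: "\<And>t. t \<in> {a..b} \<Longrightarrow> H t (x t) \<le> dx t"
    and dz: "\<And>t. t \<in> {a..b} \<Longrightarrow> dz t \<le> H t (z t)"
    and init: "x b \<le> z b" and t: "t \<in> {a..b}"
  shows "x t \<le> z t"
proof -
  obtain L where L: "\<And>s v w. s \<in> {a..b} \<Longrightarrow> \<bar>H s v - H s w\<bar> \<le> L * \<bar>v - w\<bar>"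
    using field_lipschitz[OF \<open>0 < a\<close>] by blast
  have "x t - z t \<le> 0"
  proof (rule diff_ineq_backward[where D = "\<lambda>t. x t - z t" and D' = "\<lambda>t. dx t - dz t" and a = a and b = b and L = L])
    fix s assume s: "s \<in> {a..b}"
    show "((\<lambda>t. x t - z t) has_real_derivative dx s - dz s) (at s within {a..b})"
      by (intro derivative_intros x z s)
    assume "0 < x s - z s"
    then show "- L * (x s - z s) \<le> dx s - dz s"
      using L[OF s, of "x s" "z s"] dx[OF s] dz[OF s] by auto
  qed (use init t in auto)
  then show ?thesis by simp
qed

definition solves_on :: "(real \<Rightarrow> real) \<Rightarrow> real set \<Rightarrow> bool" where
  "solves_on x A \<longleftrightarrow> (\<forall>t\<in>A. (x has_real_derivative H t (x t)) (at t within A))"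

lemma solves_on_subset: "solves_on x A \<Longrightarrow> B \<subseteq> A \<Longrightarrow> solves_on x B"
  by (auto simp: solves_on_def intro: DERIV_subset)

text \<open>A Lipschitz bound limits both growth and decay of a difference, so the order at one time
  persists in both directions. Comparing two solutions at a single point thus compares them
  everywhere.\<close>

lemma solves_on_le:
  assumes "0 < a" "solves_on x {a..b}" "solves_on z {a..b}" "s \<in> {a..b}" "t \<in> {a..b}" "x s \<le> z s"
  shows "x t \<le> z t"
proof (cases "s \<le> t")
  case True
  show ?thesis
    by (rule compare_forward[where a = s and b = t])
      (use assms True solves_on_subset[of _ "{a..b}" "{s..t}"] in \<open>auto simp: solves_on_def\<close>)
next
  case False
  show ?thesis
    by (rule compare_backward[where a = t and b = s])
      (use assms False solves_on_subset[of _ "{a..b}" "{t..s}"] in \<open>auto simp: solves_on_def\<close>)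
qed

lemma solves_on_unique:
  assumes "0 < a" "solves_on x {a..b}" "solves_on z {a..b}" "s \<in> {a..b}" "t \<in> {a..b}" "x s = z s"
  shows "x t = z t"
  using assms solves_on_le[of a x b z s t] solves_on_le[of a z b x s t] by (simp add: antisym)

lemma solves_le:
  assumes "solves_on x {0<..}" "solves_on z {0<..}" "0 < s" "0 < t" "x s \<le> z s"
  shows "x t \<le> z t"
  by (rule solves_on_le[of "min s t" x "max s t" z s])
    (use assms in \<open>auto intro!: solves_on_subset[of _ "{0<..}"]\<close>)

lemma solves_less:
  assumes "solves_on x {0<..}" "solves_on z {0<..}" "0 < s" "0 < t" "x s < z s"
  shows "x t < z t"
  using solves_le[OF assms(2,1,4,3)] assms(5) by force

lemma exists_solution:
  assumes "0 < y"
  obtains x where "x y = v" "solves_on x {0<..}"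
proof -
  \<comment> \<open>Compact intervals exhausting the positive reals. The offsets keep
    \<open>y\<close> in the interior and the left end positive even for
    \<open>n = 0\<close>.\<close>
  define I where "I n = {y / real (n + 2)..y + real (n + 1)}" for n :: nat
  have I_pos: "0 < y / real (n + 2)" for n using assms by simp
  have "\<exists>x. x y = v \<and> solves_on x (I n)" for n
  proof -
    obtain L where L: "\<And>s v w. s \<in> I n \<Longrightarrow> \<bar>H s v - H s w\<bar> \<le> L * \<bar>v - w\<bar>"
      using field_lipschitz[OF I_pos] unfolding I_def by blast
    have y: "y / real (n + 2) < y" "y < y + real (n + 1)"
      using assms by (simp_all add: divide_less_eq)
    obtain x where "x y = v"
      "\<And>t. t \<in> I n \<Longrightarrow> (x has_real_derivative H t (x t)) (at t within I n)"
      using picard[OF y field_continuous[OF I_pos] L[unfolded I_def], of v] unfolding I_def by blast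
    then show ?thesis by (auto simp: solves_on_def)
  qed
  then obtain X where X: "\<And>n. X n y = v" "\<And>n. solves_on (X n) (I n)" by metis
  have yI: "y \<in> I n" for n
    using assms by (auto simp: I_def divide_le_eq)
  have mono: "I m \<subseteq> I n" if "m \<le> n" for m n
  proof -
    have "y / real (n + 2) \<le> y / real (m + 2)"
      using assms that by (intro divide_left_mono) auto
    then show ?thesis unfolding I_def using that by (simp add: add_ac)
  qed
  have agree_le: "X m t = X n t" if "m \<le> n" "t \<in> I m" for m n t
  proof (rule solves_on_unique[OF I_pos[of m], where x = "X m" and z = "X n"
        and b = "y + real (m + 1)" and s = y and t = t])
    show "solves_on (X m) {y / real (m + 2)..y + real (m + 1)}" using X(2)[of m] by (simp add: I_def)
    show "solves_on (X n) {y / real (m + 2)..y + real (m + 1)}"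
      using solves_on_subset[OF X(2)[of n] mono[OF that(1)]] by (simp add: I_def)
    show "y \<in> {y / real (m + 2)..y + real (m + 1)}" using yI[of m] by (simp add: I_def)
    show "t \<in> {y / real (m + 2)..y + real (m + 1)}" using that by (simp add: I_def)
  qed (simp add: X(1))
  have agree: "X m t = X n t" if "t \<in> I m" "t \<in> I n" for m n t
    using agree_le[OF _ that(1)] agree_le[OF _ that(2)] by (metis nat_le_linear)
  have cover: "\<exists>n. y / real (n + 2) < t \<and> t < y + real (n + 1)" if "0 < t" for t
  proof -
    obtain n :: nat where n: "max (y / t) t < real n" using reals_Archimedean2 by blast
    then have "y < real n * t" using that by (simp add: pos_divide_less_eq)
    also have "\<dots> \<le> real (n + 2) * t" using that by simp
    finally have "y / real (n + 2) < t" by (simp add: pos_divide_less_eq mult.commute)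
    moreover have "t < y + real (n + 1)" using n assms by simp
    ultimately show ?thesis by blast
  qed
  \<comment> \<open>An interval with \<open>t\<close> strictly inside, so that the derivative within
    it is a full derivative at \<open>t\<close>.\<close>
  define N where "N t = (SOME n. y / real (n + 2) < t \<and> t < y + real (n + 1))" for t
  have N: "y / real (N t + 2) < t" "t < y + real (N t + 1)" if "0 < t" for t
    using someI_ex[OF cover[OF that]] unfolding N_def[symmetric] by blast+
  define x where "x t = X (N t) t" for t
  have xX: "x t = X n t" if "t \<in> I n" "0 < t" for t n
  proof -
    have "t \<in> I (N t)" using N[OF that(2)] by (simp add: I_def)
    then show ?thesis unfolding x_def by (rule agree) (fact that(1))
  qed
  have "solves_on x {0<..}" unfolding solves_on_def
  proof
    fix t :: real assume "t \<in> {0<..}"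
    then have t: "0 < t" by simp
    let ?J = "{y / real (N t + 2)<..<y + real (N t + 1)}"
    have "(X (N t) has_real_derivative H t (X (N t) t)) (at t)"
      using X(2)[of "N t"] N[OF t] at_within_Icc_at[OF N[OF t]]
      unfolding solves_on_def I_def by (metis atLeastAtMost_iff less_imp_le)
    then have "(x has_real_derivative H t (X (N t) t)) (at t)"
    proof (rule has_field_derivative_transform_within_open[of _ _ _ ?J])
      fix s assume s: "s \<in> ?J"
      then have "0 < s" using I_pos[of "N t"] by (meson greaterThanLessThan_iff less_trans)
      moreover have "s \<in> I (N t)" using s by (simp add: I_def)
      ultimately show "X (N t) s = x s" by (simp add: xX)
    next
      show "t \<in> ?J" using N[OF t] by simp
    qed simp
    then show "(x has_real_derivative H t (x t)) (at t within {0<..})"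
      by (simp add: x_def has_field_derivative_at_within)
  qed
  moreover have "x y = v" using X(1) by (simp add: x_def)
  ultimately show ?thesis using that by blast
qed

end

section \<open>The characteristic root\<close>

context
  fixes \<tau> :: nat and \<alpha> :: real
  assumes tau: "2 \<le> \<tau>" and alpha: "alpha_star \<tau> \<le> \<alpha>"
begin

definition char_poly :: "real \<Rightarrow> real" where
  "char_poly z = z ^ \<tau> - \<alpha> / (real \<tau> - 1) * (z ^ (\<tau> - 1) - 1)"

text \<open>The value of \<open>char_poly\<close> here is \<open>alpha_star\<close> minus alpha; in
  the boundary case this point is the double root.\<close>

definition threshold_root :: real where
  "threshold_root = real \<tau> powr (1 / (real \<tau> - 1))"

lemma threshold_root_pos: "0 < threshold_root"
  using tau by (simp add: threshold_root_def)

lemma threshold_root_power: "threshold_root ^ (\<tau> - 1) = real \<tau>"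
proof -
  have "threshold_root ^ (\<tau> - 1) = threshold_root powr real (\<tau> - 1)"
    using threshold_root_pos by (simp add: powr_realpow)
  also have "\<dots> = real \<tau>"
    using tau by (simp add: threshold_root_def powr_powr of_nat_diff)
  finally show ?thesis .
qed

lemma threshold_root_power': "threshold_root ^ \<tau> = alpha_star \<tau>"
proof -
  have "threshold_root ^ \<tau> = threshold_root powr real \<tau>"
    using threshold_root_pos by (simp add: powr_realpow)
  then show ?thesis by (simp add: threshold_root_def powr_powr alpha_star_def)
qed

lemma alpha_pos: "0 < \<alpha>"
  using alpha threshold_root_power' threshold_root_pos
  by (metis less_le_trans zero_less_power)

lemma char_poly_threshold: "char_poly threshold_root \<le> 0"
  using alpha tau unfolding char_poly_def threshold_root_power threshold_root_power' by simp

lemma char_poly_pos_large: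
  assumes "\<alpha> < z" shows "0 < char_poly z"
proof -
  have z: "0 < z" using assms alpha_pos by simp
  have "\<alpha> / (real \<tau> - 1) * (z ^ (\<tau> - 1) - 1) < \<alpha> / (real \<tau> - 1) * z ^ (\<tau> - 1)"
    using alpha_pos tau by (intro mult_strict_left_mono) auto
  also have "\<dots> \<le> \<alpha> * z ^ (\<tau> - 1)"
    using alpha_pos tau z by (intro mult_right_mono) (auto simp: divide_le_eq)
  also have "\<dots> \<le> z * z ^ (\<tau> - 1)" using assms z by (intro mult_right_mono) auto
  also have "\<dots> = z ^ \<tau>" using tau by (simp add: power_eq_if)
  finally show ?thesis by (simp add: char_poly_def)
qed

lemma continuous_on_char_poly: "continuous_on A char_poly"
  unfolding char_poly_def by (intro continuous_intros)

lemma char_poly_root_ge: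
  assumes "0 < z" "char_poly z \<le> 0"
  obtains r where "z \<le> r" "char_poly r = 0"
proof -
  have "char_poly z \<le> 0" "0 \<le> char_poly (max (\<alpha> + 1) z)"
    using assms char_poly_pos_large[of "max (\<alpha> + 1) z"] by (auto simp: less_max_iff_disj)
  then show ?thesis
    using IVT'[of char_poly z 0 "max (\<alpha> + 1) z"] continuous_on_char_poly that by auto
qed

lemma finite_char_roots: "finite {z. 0 < z \<and> char_poly z = 0}"
proof -
  let ?p = "monom 1 \<tau> - smult (\<alpha> / (real \<tau> - 1)) (monom 1 (\<tau> - 1) - 1)"
  have p: "poly ?p z = char_poly z" for z
    unfolding char_poly_def by (simp add: poly_monom del: One_nat_def)
  have "?p \<noteq> 0" using p[of "\<alpha> + 1"] char_poly_pos_large[of "\<alpha> + 1"] by force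
  then have "finite {z. poly ?p z = 0}" by (rule poly_roots_finite)
  then show ?thesis unfolding p by (rule rev_finite_subset) auto
qed

lemma chi_plus_eq: "chi_plus \<tau> \<alpha> = Max {z. 0 < z \<and> char_poly z = 0}"
  by (simp add: chi_plus_def char_poly_def)

text \<open>\<open>char_poly\<close> is positive beyond alpha, so to the right of any point where it
  is nonpositive there is another root, and the largest root lies at least that far.\<close>

lemma le_chi_plus:
  assumes "0 < z" "char_poly z \<le> 0" shows "z \<le> chi_plus \<tau> \<alpha>"
proof -
  obtain r where r: "z \<le> r" "char_poly r = 0" using assms by (rule char_poly_root_ge)
  then have "r \<le> chi_plus \<tau> \<alpha>"
    unfolding chi_plus_eq using finite_char_roots assms by (intro Max_ge) auto
  then show ?thesis using r by simp
qed

lemma chi_plus_ge_threshold: "threshold_root \<le> chi_plus \<tau> \<alpha>"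
  by (rule le_chi_plus[OF threshold_root_pos char_poly_threshold])

lemma chi_plus_root: "char_poly (chi_plus \<tau> \<alpha>) = 0"
proof -
  obtain r where "threshold_root \<le> r" "char_poly r = 0"
    using threshold_root_pos char_poly_threshold by (rule char_poly_root_ge)
  then have "{z. 0 < z \<and> char_poly z = 0} \<noteq> {}" using threshold_root_pos by force
  then have "chi_plus \<tau> \<alpha> \<in> {z. 0 < z \<and> char_poly z = 0}"
    unfolding chi_plus_eq using finite_char_roots by (intro Max_in)
  then show ?thesis by simp
qed

lemma chi_plus_power: "real \<tau> \<le> chi_plus \<tau> \<alpha> ^ (\<tau> - 1)"
  using power_mono[OF chi_plus_ge_threshold, of "\<tau> - 1"] threshold_root_pos
  unfolding threshold_root_power by simp

lemma chi_plus_gt_1: "1 < chi_plus \<tau> \<alpha>"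
proof (rule ccontr)
  assume "\<not> 1 < chi_plus \<tau> \<alpha>"
  then have "chi_plus \<tau> \<alpha> ^ (\<tau> - 1) \<le> 1"
    using chi_plus_ge_threshold threshold_root_pos by (intro power_le_one) auto
  then show False using chi_plus_power tau by simp
qed

text \<open>For a pure power of degree tau and values at most 1, the field at
  \<open>(u, z * u)\<close> is exactly this function of \<open>z\<close>. A ray is then a solution
  precisely when its ratio is a fixed point.\<close>

definition slope_map :: "real \<Rightarrow> real" where
  "slope_map z = \<alpha> * (1 - 1 / z ^ (\<tau> - 1)) / (real \<tau> - 1)"

lemma slope_map_minus:
  assumes "0 < z" shows "(z - slope_map z) * z ^ (\<tau> - 1) = char_poly z"
proof -
  have "(z - slope_map z) * z ^ (\<tau> - 1)
      = z * z ^ (\<tau> - 1) - \<alpha> / (real \<tau> - 1) * ((1 - 1 / z ^ (\<tau> - 1)) * z ^ (\<tau> - 1))"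
    unfolding slope_map_def left_diff_distrib[of z] by simp
  also have "(1 - 1 / z ^ (\<tau> - 1)) * z ^ (\<tau> - 1) = z ^ (\<tau> - 1) - 1"
    using assms by (simp add: left_diff_distrib)
  also have "z * z ^ (\<tau> - 1) = z ^ \<tau>" using tau by (simp add: power_eq_if)
  finally show ?thesis by (simp add: char_poly_def)
qed

lemma slope_map_chi: "slope_map (chi_plus \<tau> \<alpha>) = chi_plus \<tau> \<alpha>"
  using slope_map_minus[of "chi_plus \<tau> \<alpha>"] chi_plus_root chi_plus_gt_1 by simp

lemma le_slope_map_imp_le_chi:
  assumes "0 < z" "z \<le> slope_map z" shows "z \<le> chi_plus \<tau> \<alpha>"
proof (rule le_chi_plus[OF assms(1)])
  have "(z - slope_map z) * z ^ (\<tau> - 1) \<le> 0"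
    using assms by (intro mult_nonpos_nonneg) auto
  then show "char_poly z \<le> 0" using slope_map_minus[OF assms(1)] by simp
qed

lemma slope_map_mono:
  assumes "0 < y" "y \<le> z" shows "slope_map y \<le> slope_map z"
proof -
  have "1 / z ^ (\<tau> - 1) \<le> 1 / y ^ (\<tau> - 1)"
    using assms by (intro divide_left_mono power_mono mult_pos_pos) auto
  then show ?thesis
    unfolding slope_map_def using alpha_pos tau
    by (intro divide_right_mono mult_left_mono) auto
qed

lemma slope_map_le: "0 < z \<Longrightarrow> slope_map z \<le> \<alpha> / (real \<tau> - 1)"
  unfolding slope_map_def using alpha_pos tau
  by (intro divide_right_mono) (auto simp: mult_left_le)

text \<open>At the fixed point the slope map has derivative \<open>(\<tau> - 1) / (\<chi> ^ (\<tau> - 1) - 1) \<le> 1\<close>.\<close>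

lemma slope_map_below_chi:
  obtains d where "0 < d"
    "\<And>x. 0 < x \<Longrightarrow> x < d \<Longrightarrow> chi_plus \<tau> \<alpha> - 3 / 2 * x < slope_map (chi_plus \<tau> \<alpha> - x)"
proof -
  define w where "w = chi_plus \<tau> \<alpha>"
  have chi: "1 < w" "real \<tau> \<le> w ^ (\<tau> - 1)" "char_poly w = 0"
    using chi_plus_gt_1 chi_plus_power chi_plus_root by (auto simp: w_def)
  have "(slope_map has_real_derivative \<alpha> * (real (\<tau> - 1) * w ^ (\<tau> - 1 - 1) / (w ^ (\<tau> - 1))^2) / (real \<tau> - 1)) (at w)"
    unfolding slope_map_def using chi tau
    by (auto intro!: derivative_eq_intros simp: power2_eq_square)
  moreover have "\<alpha> * (real (\<tau> - 1) * w ^ (\<tau> - 1 - 1) / (w ^ (\<tau> - 1))^2) / (real \<tau> - 1) = \<alpha> / w ^ \<tau>"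
  proof -
    obtain n where n: "\<tau> = n + 2" using tau by (metis add.commute le_Suc_ex)
    have "(w ^ (n + 1))\<^sup>2 = w ^ n * w ^ (n + 2)"
      by (simp add: power_add[symmetric] power2_eq_square)
    then have "real (n + 1) * w ^ n / (w ^ (n + 1))\<^sup>2 = real (n + 1) / w ^ (n + 2)"
      using chi by simp
    then show ?thesis unfolding n by simp
  qed
  ultimately have "(slope_map has_real_derivative \<alpha> / w ^ \<tau>) (at w)" by simp
  \<comment> \<open>The number 3/2 lies strictly between 1, which bounds the derivative even at a
    double root, and 2, the factor gained by differentiating the parabola's quadratic term.\<close>
  then have der: "((\<lambda>z. slope_map z - 3 / 2 * z) has_real_derivative \<alpha> / w ^ \<tau> - 3 / 2) (at w)"
    by (auto intro!: derivative_eq_intros)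
  have "\<alpha> / w ^ \<tau> \<le> 1"
  proof -
    have "\<alpha> = \<alpha> / (real \<tau> - 1) * (real \<tau> - 1)" using tau by simp
    also have "\<dots> \<le> \<alpha> / (real \<tau> - 1) * (w ^ (\<tau> - 1) - 1)"
      using chi(2) alpha_pos tau by (intro mult_left_mono) auto
    also have "\<dots> = w ^ \<tau>" using chi(3) by (simp add: char_poly_def)
    finally show ?thesis using chi(1) by (simp add: divide_le_eq)
  qed
  then have "\<alpha> / w ^ \<tau> - 3 / 2 < 0" by linarith
  from DERIV_neg_dec_left[OF der this] obtain d where d: "0 < d"
    "\<And>x. 0 < x \<Longrightarrow> x < d \<Longrightarrow> slope_map w - 3 / 2 * w < slope_map (w - x) - 3 / 2 * (w - x)"
    by blast
  show ?thesis
  proof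
    show "0 < d" by fact
    fix x assume "0 < x" "x < d"
    from d(2)[OF this] show "chi_plus \<tau> \<alpha> - 3 / 2 * x < slope_map (chi_plus \<tau> \<alpha> - x)"
      using slope_map_chi by (simp add: w_def algebra_simps)
  qed
qed

end

section \<open>The vector field of the reserve equation\<close>

text \<open>Up to the factor \<open>1 - r\<close>, the quotient \<open>(1 - r ^ n) / n\<close> is
  the mean of the first \<open>n\<close> powers of \<open>r\<close>, and these means decrease with
  \<open>n\<close>. This compares each term of the cost with the one of degree tau.\<close>

lemma power_difference_ratio:
  fixes r :: real
  assumes "0 \<le> r" "r \<le> 1" "n \<le> j"
  shows "real n * (1 - r ^ j) \<le> real j * (1 - r ^ n)"
  using assms(3)
proof (induction j rule: dec_induct)
  case base show ?case by simp
next
  case (step j)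
  have "real n * r ^ j \<le> (\<Sum>i<n. r ^ i)"
  proof -
    have "(\<Sum>i<n. r ^ j) \<le> (\<Sum>i<n. r ^ i)"
      using assms step by (intro sum_mono power_decreasing) auto
    then show ?thesis by simp
  qed
  then have "(1 - r) * (real n * r ^ j) \<le> (1 - r) * (\<Sum>i<n. r ^ i)"
    using assms by (intro mult_left_mono) auto
  also have "\<dots> = 1 - r ^ n" by (rule one_diff_power_eq[symmetric])
  finally have "real n * r ^ j * (1 - r) \<le> 1 - r ^ n" by (simp add: mult_ac)
  moreover have "real n * (1 - r ^ Suc j) = real n * (1 - r ^ j) + real n * r ^ j * (1 - r)"
    by (simp add: algebra_simps)
  ultimately show ?case using step.IH by (simp add: algebra_simps)
qed

text \<open>The factor \<open>m\<close> is constant \<open>1\<close> for the unlimited equation and \<open>max 1\<close> for the limited one: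
  \<open>1 / min v 1 = max 1 v / v\<close> for \<open>v > 0\<close>.\<close>

locale reserve_equation =
  fixes \<tau> \<sigma> :: nat and c :: "nat \<Rightarrow> real" and \<alpha> :: real and m :: "real \<Rightarrow> real"
  assumes tau: "2 \<le> \<tau>" "\<tau> \<le> \<sigma>"
    and c_nonneg: "k \<in> {\<tau>..\<sigma>} \<Longrightarrow> 0 \<le> c k" and c_pos: "0 < c \<tau>"
    and alpha: "alpha_star \<tau> \<le> \<alpha>"
    and m_lipschitz: "\<bar>m v - m w\<bar> \<le> \<bar>v - w\<bar>" and m_ge: "1 \<le> m v" and m_le: "m v \<le> max 1 v"
begin

text \<open>In terms of the cost function \<open>f\<close>: \<open>g v = f' v\<close>, \<open>h v = v * f'' v\<close> and \<open>h2 v = v * h' v\<close>.\<close>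

definition g :: "real \<Rightarrow> real" where
  "g v = (\<Sum>k=\<tau>..\<sigma>. real k * c k * v ^ (k - 1))"

definition h :: "real \<Rightarrow> real" where
  "h v = (\<Sum>k=\<tau>..\<sigma>. real (k - 1) * (real k * c k) * v ^ (k - 1))"

definition h2 :: "real \<Rightarrow> real" where
  "h2 v = (\<Sum>k=\<tau>..\<sigma>. real (k - 1) * real (k - 1) * (real k * c k) * v ^ (k - 1))"

definition field :: "real \<Rightarrow> real \<Rightarrow> real" where
  "field u v = \<alpha> * m v * (g v - g u) / h v"

definition clamped :: "real \<Rightarrow> real \<Rightarrow> real" where
  "clamped u v = field u (max v u)"

lemma alpha_pos': "0 < \<alpha>"
  using alpha_pos[OF tau(1) alpha] .

lemma m_eq_1: "v \<le> 1 \<Longrightarrow> m v = 1"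
  using m_ge[of v] m_le[of v] by simp

lemma g_nonneg: "0 \<le> v \<Longrightarrow> 0 \<le> g v"
  unfolding g_def using c_nonneg by (intro sum_nonneg) auto

lemma h_pos: assumes "0 < v" shows "0 < h v"
  unfolding h_def
proof (rule sum_pos2[where i = \<tau>])
  show "0 < real (\<tau> - 1) * (real \<tau> * c \<tau>) * v ^ (\<tau> - 1)"
    using tau c_pos assms by simp
qed (use tau assms c_nonneg in auto)

lemma h_mono: "0 \<le> v \<Longrightarrow> v \<le> w \<Longrightarrow> h v \<le> h w"
  unfolding h_def using c_nonneg by (intro sum_mono mult_left_mono power_mono) auto

lemma g_le_h: assumes "0 \<le> v" shows "g v \<le> h v"
  unfolding g_def h_def
proof (rule sum_mono)
  fix k assume k: "k \<in> {\<tau>..\<sigma>}"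
  have "1 * (real k * c k) \<le> real (k - 1) * (real k * c k)"
    using k tau c_nonneg[OF k] by (intro mult_right_mono) auto
  then show "real k * c k * v ^ (k - 1) \<le> real (k - 1) * (real k * c k) * v ^ (k - 1)"
    using assms by (intro mult_right_mono) auto
qed

lemma h2_nonneg: "0 \<le> v \<Longrightarrow> 0 \<le> h2 v"
  unfolding h2_def using c_nonneg by (intro sum_nonneg) auto

lemma h2_le: assumes "0 \<le> v" shows "h2 v \<le> real \<sigma> * h v"
  unfolding h2_def h_def sum_distrib_left
proof (rule sum_mono)
  fix k assume k: "k \<in> {\<tau>..\<sigma>}"
  have "real (k - 1) * (real (k - 1) * (real k * c k) * v ^ (k - 1))
      \<le> real \<sigma> * (real (k - 1) * (real k * c k) * v ^ (k - 1))"
    using k tau c_nonneg[OF k] assms by (intro mult_right_mono) auto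
  then show "real (k - 1) * real (k - 1) * (real k * c k) * v ^ (k - 1)
      \<le> real \<sigma> * (real (k - 1) * (real k * c k) * v ^ (k - 1))" by (simp add: mult_ac)
qed

lemma power_pred_deriv:
  assumes "0 < v" "2 \<le> k"
  shows "((\<lambda>v::real. v ^ (k - 1)) has_real_derivative real (k - 1) * v ^ (k - 1) / v) (at v)"
proof -
  have "v ^ (k - 1) = v * v ^ (k - 1 - 1)" using assms by (simp add: power_eq_if)
  then have "real (k - 1) * v ^ (k - 1) / v = real (k - 1) * v ^ (k - 1 - 1)"
    using assms by simp
  then show ?thesis by (auto intro!: derivative_eq_intros)
qed

lemma g_deriv: assumes "0 < v" shows "(g has_real_derivative h v / v) (at v)"
proof -
  have "((\<lambda>v. \<Sum>k=\<tau>..\<sigma>. real k * c k * v ^ (k - 1)) has_real_derivative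
      (\<Sum>k=\<tau>..\<sigma>. real k * c k * (real (k - 1) * v ^ (k - 1) / v))) (at v)"
    using tau by (intro DERIV_sum DERIV_cmult power_pred_deriv assms) auto
  then show ?thesis
    unfolding g_def[abs_def] h_def sum_divide_distrib by (simp add: mult_ac)
qed

lemma h_deriv: assumes "0 < v" shows "(h has_real_derivative h2 v / v) (at v)"
proof -
  have "((\<lambda>v. \<Sum>k=\<tau>..\<sigma>. real (k - 1) * (real k * c k) * v ^ (k - 1)) has_real_derivative
      (\<Sum>k=\<tau>..\<sigma>. real (k - 1) * (real k * c k) * (real (k - 1) * v ^ (k - 1) / v))) (at v)"
    using tau by (intro DERIV_sum DERIV_cmult power_pred_deriv assms) auto
  then show ?thesis
    unfolding h_def[abs_def] h2_def sum_divide_distrib by (simp add: mult_ac)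
qed

lemma g_less: assumes "0 \<le> u" "u < v" shows "g u < g v"
  unfolding g_def
proof (rule sum_strict_mono_ex1)
  show "\<forall>k\<in>{\<tau>..\<sigma>}. real k * c k * u ^ (k - 1) \<le> real k * c k * v ^ (k - 1)"
    using assms c_nonneg by (auto intro!: mult_left_mono power_mono)
  have "u ^ (\<tau> - 1) < v ^ (\<tau> - 1)"
    using assms tau by (intro power_strict_mono) auto
  then show "\<exists>k\<in>{\<tau>..\<sigma>}. real k * c k * u ^ (k - 1) < real k * c k * v ^ (k - 1)"
    using tau c_pos by (intro bexI[of _ \<tau>] mult_strict_left_mono) auto
qed simp

lemma g_le: "0 \<le> u \<Longrightarrow> u \<le> v \<Longrightarrow> g u \<le> g v"
  using g_less[of u v] by (cases "u = v") auto

lemma field_nonneg: "0 < u \<Longrightarrow> u \<le> v \<Longrightarrow> 0 \<le> field u v"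
  unfolding field_def using alpha_pos' m_ge[of v] g_le[of u v] h_pos[of v] by simp

lemma field_pos: "0 < u \<Longrightarrow> u < v \<Longrightarrow> 0 < field u v"
  unfolding field_def using alpha_pos' m_ge[of v] g_less[of u v] h_pos[of v] by simp

lemma field_diag: "field u u = 0"
  by (simp add: field_def)

lemma clamped_eq: "u \<le> v \<Longrightarrow> clamped u v = field u v"
  by (simp add: clamped_def max_def)

lemma clamped_below: "v \<le> u \<Longrightarrow> clamped u v = 0"
  by (simp add: clamped_def field_diag max_def)

lemma clamped_nonneg: "0 < u \<Longrightarrow> 0 \<le> clamped u v"
  by (simp add: clamped_def field_nonneg)

text \<open>The factor \<open>m\<close> may grow linearly, so a bounded derivative of
  \<open>q\<close> would not suffice on an unbounded range. Decay like \<open>1 / v\<close> does: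
  \<open>m v / v\<close> is at most \<open>1 + 1 / lo\<close>.\<close>

lemma lipschitz_m_mult:
  assumes lo: "0 < lo"
    and deriv: "\<And>v. lo \<le> v \<Longrightarrow> (q has_real_derivative q' v) (at v)"
    and bound: "\<And>v. lo \<le> v \<Longrightarrow> \<bar>q' v\<bar> \<le> B * real \<sigma> / v"
    and q: "\<And>v. lo \<le> v \<Longrightarrow> \<bar>q v\<bar> \<le> B"
    and vw: "lo \<le> v" "lo \<le> w"
  shows "\<bar>m v * q v - m w * q w\<bar> \<le> B * (1 + real \<sigma> * (1 + 1 / lo)) * \<bar>v - w\<bar>"
proof -
  have B: "0 \<le> B" using q[of lo] by linarith
  have "\<bar>m v * q v - m w * q w\<bar> \<le> B * (1 + real \<sigma> * (1 + 1 / lo)) * \<bar>v - w\<bar>"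
    if vw: "lo \<le> v" "v \<le> w" for v w
  proof -
    have "\<bar>q w - q v\<bar> \<le> B * real \<sigma> / v * (w - v)"
    proof (cases "v = w")
      case False
      then have "v < w" using vw by simp
      then obtain z where z: "v < z" "z < w" "q w - q v = (w - v) * q' z"
        using MVT2[of v w q q'] deriv vw by (metis order_trans)
      have "\<bar>q' z\<bar> \<le> B * real \<sigma> / z" using bound[of z] z vw by simp
      also have "\<dots> \<le> B * real \<sigma> / v"
        using z vw lo B by (intro divide_left_mono) auto
      finally have "\<bar>q' z\<bar> * (w - v) \<le> B * real \<sigma> / v * (w - v)"
        using vw by (intro mult_right_mono) auto
      then show ?thesis using vw by (simp add: z(3) abs_mult mult.commute)
    qed simp
    then have "m v * \<bar>q w - q v\<bar> \<le> m v * (B * real \<sigma> / v * (w - v))"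
      using m_ge[of v] by (intro mult_left_mono) auto
    also have "\<dots> = (m v / v) * (B * real \<sigma> * (w - v))" by simp
    also have "\<dots> \<le> (1 + 1 / lo) * (B * real \<sigma> * (w - v))"
    proof (rule mult_right_mono)
      have "m v / v \<le> (1 + v) / v"
        using m_le[of v] vw lo by (intro divide_right_mono) auto
      also have "\<dots> = 1 + 1 / v" using vw lo by (simp add: add_divide_distrib)
      also have "1 / v \<le> 1 / lo" using vw lo by (intro divide_left_mono) auto
      finally show "m v / v \<le> 1 + 1 / lo" by simp
    qed (use B vw in auto)
    finally have 1: "m v * \<bar>q w - q v\<bar> \<le> (1 + 1 / lo) * (B * real \<sigma> * (w - v))" .
    have 2: "\<bar>m w - m v\<bar> * \<bar>q w\<bar> \<le> (w - v) * B"
      using m_lipschitz[of w v] q[of w] vw by (intro mult_mono) auto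
    have "m v * q v - m w * q w = - (m v * (q w - q v) + (m w - m v) * q w)"
      by (simp add: algebra_simps)
    then have "\<bar>m v * q v - m w * q w\<bar> \<le> \<bar>m v * (q w - q v)\<bar> + \<bar>(m w - m v) * q w\<bar>"
      using abs_triangle_ineq by (metis abs_minus_cancel)
    also have "\<dots> \<le> (1 + 1 / lo) * (B * real \<sigma> * (w - v)) + (w - v) * B"
      using 1 2 m_ge[of v] by (simp add: abs_mult)
    also have "\<dots> = B * (1 + real \<sigma> * (1 + 1 / lo)) * (w - v)"
      by (simp add: algebra_simps diff_divide_distrib)
    finally show ?thesis using vw by simp
  qed
  from this[of v w] this[of w v] show ?thesis
    using vw by (cases "v \<le> w") (auto simp: abs_minus_commute)
qed

text \<open>The field is split into multiples of \<open>m * (g / h)\<close> and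
  \<open>m / h\<close>, the latter weighted by \<open>g u\<close>. As \<open>v * g' = h\<close> and
  \<open>v * h' = h2\<close>, with \<open>g\<close> at most \<open>h\<close> and \<open>h2\<close>
  at most \<open>\<sigma> * h\<close>, both quotients have derivatives of order
  \<open>1 / v\<close>.\<close>

lemma field_lipschitz:
  assumes lo: "0 < lo"
  obtains L where "0 \<le> L"
    "\<And>u v w. 0 < u \<Longrightarrow> u \<le> b \<Longrightarrow> lo \<le> v \<Longrightarrow> lo \<le> w \<Longrightarrow> \<bar>field u v - field u w\<bar> \<le> L * \<bar>v - w\<bar>"
proof -
  define q1 where "q1 v = g v / h v" for v
  define q2 where "q2 v = 1 / h v" for v
  define M where "M = 1 + real \<sigma> * (1 + 1 / lo)"
  have M: "0 \<le> M" using lo by (simp add: M_def)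
  have q1: "\<bar>m v * q1 v - m w * q1 w\<bar> \<le> 1 * M * \<bar>v - w\<bar>" if "lo \<le> v" "lo \<le> w" for v w
    unfolding M_def
  proof (rule lipschitz_m_mult[OF lo _ _ _ that])
    fix v assume v: "lo \<le> v"
    then have vp: "0 < v" using lo by simp
    have hp: "0 < h v" by (rule h_pos[OF vp])
    show "(q1 has_real_derivative (1 - g v / h v * (h2 v / h v)) / v) (at v)"
      unfolding q1_def using hp vp
      by (auto intro!: derivative_eq_intros g_deriv h_deriv simp: field_simps)
    have a: "0 \<le> g v / h v" "g v / h v \<le> 1"
      using g_nonneg g_le_h[of v] hp vp by auto
    have b: "0 \<le> h2 v / h v" "h2 v / h v \<le> real \<sigma>"
      using h2_nonneg h2_le[of v] hp vp by (auto simp: divide_le_eq)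
    have "g v / h v * (h2 v / h v) \<le> 1 * real \<sigma>" "0 \<le> g v / h v * (h2 v / h v)"
      by (rule mult_mono[OF a(2) b(2) _ b(1)], simp) (rule mult_nonneg_nonneg[OF a(1) b(1)])
    then have "\<bar>1 - g v / h v * (h2 v / h v)\<bar> \<le> real \<sigma>" using tau by linarith
    then show "\<bar>(1 - g v / h v * (h2 v / h v)) / v\<bar> \<le> 1 * real \<sigma> / v"
      using vp by (simp add: abs_divide divide_right_mono)
    show "\<bar>q1 v\<bar> \<le> 1" using a by (simp add: q1_def)
  qed
  have q2: "\<bar>m v * q2 v - m w * q2 w\<bar> \<le> 1 / h lo * M * \<bar>v - w\<bar>" if "lo \<le> v" "lo \<le> w" for v w
    unfolding M_def
  proof (rule lipschitz_m_mult[OF lo _ _ _ that])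
    fix v assume v: "lo \<le> v"
    then have vp: "0 < v" using lo by simp
    have hp: "0 < h v" by (rule h_pos[OF vp])
    show "(q2 has_real_derivative - (1 / h v * (h2 v / h v)) / v) (at v)"
      unfolding q2_def using hp vp
      by (auto intro!: derivative_eq_intros h_deriv simp: field_simps)
    have a: "0 \<le> 1 / h v" "1 / h v \<le> 1 / h lo"
      using h_mono[of lo v] h_pos[OF lo] hp v lo by (auto intro: divide_left_mono)
    have b: "0 \<le> h2 v / h v" "h2 v / h v \<le> real \<sigma>"
      using h2_nonneg h2_le[of v] hp vp by (auto simp: divide_le_eq)
    have "1 / h v * (h2 v / h v) \<le> 1 / h lo * real \<sigma>" "0 \<le> 1 / h v * (h2 v / h v)"
      by (rule mult_mono[OF a(2) b(2) order_trans[OF a] b(1)]) (rule mult_nonneg_nonneg[OF a(1) b(1)])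
    then have "\<bar>- (1 / h v * (h2 v / h v))\<bar> \<le> 1 / h lo * real \<sigma>" by linarith
    then show "\<bar>- (1 / h v * (h2 v / h v)) / v\<bar> \<le> 1 / h lo * real \<sigma> / v"
      using vp unfolding abs_divide by (simp add: divide_right_mono del: times_divide_eq_left times_divide_eq_right)
    show "\<bar>q2 v\<bar> \<le> 1 / h lo" using a by (simp add: q2_def)
  qed
  define L where "L = \<alpha> * (M + \<bar>g b\<bar> * (1 / h lo * M))"
  show ?thesis
  proof
    show "0 \<le> L" using M alpha_pos' h_pos[OF lo] by (simp add: L_def)
    fix u v w assume u: "0 < u" "u \<le> b" and vw: "lo \<le> v" "lo \<le> w"
    have "field u v - field u w = \<alpha> * ((m v * q1 v - m w * q1 w) - g u * (m v * q2 v - m w * q2 w))"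
      by (simp add: field_def q1_def q2_def algebra_simps diff_divide_distrib)
    then have "\<bar>field u v - field u w\<bar>
        = \<alpha> * \<bar>(m v * q1 v - m w * q1 w) - g u * (m v * q2 v - m w * q2 w)\<bar>"
      using alpha_pos' by (simp add: abs_mult)
    also have "\<dots> \<le> \<alpha> * (1 * M * \<bar>v - w\<bar> + \<bar>g b\<bar> * (1 / h lo * M * \<bar>v - w\<bar>))"
    proof (rule mult_left_mono)
      have "\<bar>g u\<bar> \<le> \<bar>g b\<bar>" using g_nonneg[of u] g_le[of u b] u by simp
      then have "\<bar>g u * (m v * q2 v - m w * q2 w)\<bar> \<le> \<bar>g b\<bar> * (1 / h lo * M * \<bar>v - w\<bar>)"
        unfolding abs_mult by (intro mult_mono q2 vw) auto
      then show "\<bar>(m v * q1 v - m w * q1 w) - g u * (m v * q2 v - m w * q2 w)\<bar>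
          \<le> 1 * M * \<bar>v - w\<bar> + \<bar>g b\<bar> * (1 / h lo * M * \<bar>v - w\<bar>)"
        using q1[OF vw] by linarith
    qed (use alpha_pos' in simp)
    also have "\<dots> = L * \<bar>v - w\<bar>" by (simp add: L_def algebra_simps)
    finally show "\<bar>field u v - field u w\<bar> \<le> L * \<bar>v - w\<bar>" .
  qed
qed

lemma continuous_on_g: "continuous_on A g"
  unfolding g_def by (intro continuous_intros)

lemma continuous_on_h: "continuous_on A h"
  unfolding h_def by (intro continuous_intros)

lemma continuous_on_m: "continuous_on A m"
  unfolding continuous_on_iff dist_real_def
  using m_lipschitz by (meson le_less_trans)

text \<open>Clamping keeps the second argument of \<open>field\<close> at least \<open>a\<close>, so
  \<open>field_lipschitz\<close> with \<open>lo = a\<close> yields one constant for all real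
  values.\<close>

sublocale clamped: lipschitz_field clamped
proof
  fix a b :: real assume a: "0 < a"
  show "continuous_on ({a..b} \<times> UNIV) (\<lambda>(s, v). clamped s v)"
    unfolding clamped_def field_def case_prod_beta
  proof (intro continuous_intros continuous_on_compose2[OF continuous_on_g]
      continuous_on_compose2[OF continuous_on_h] continuous_on_compose2[OF continuous_on_m])
    show "\<forall>x\<in>{a..b} \<times> UNIV. h (max (snd x) (fst x)) \<noteq> 0"
      using a h_pos by (auto intro!: less_imp_neq[symmetric] simp: less_max_iff_disj)
  qed auto
  obtain L where L: "0 \<le> L"
    "\<And>u v w. 0 < u \<Longrightarrow> u \<le> b \<Longrightarrow> a \<le> v \<Longrightarrow> a \<le> w \<Longrightarrow> \<bar>field u v - field u w\<bar> \<le> L * \<bar>v - w\<bar>"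
    using field_lipschitz[OF a, of b] by blast
  have "\<bar>clamped s v - clamped s w\<bar> \<le> L * \<bar>v - w\<bar>" if "s \<in> {a..b}" for s v w
  proof -
    have "\<bar>clamped s v - clamped s w\<bar> \<le> L * \<bar>max v s - max w s\<bar>"
      unfolding clamped_def using that a by (intro L) auto
    also have "\<dots> \<le> L * \<bar>v - w\<bar>" using L(1) by (intro mult_left_mono) auto
    finally show ?thesis .
  qed
  then show "\<exists>L. \<forall>s\<in>{a..b}. \<forall>v w. \<bar>clamped s v - clamped s w\<bar> \<le> L * \<bar>v - w\<bar>" by blast
qed

section \<open>Comparison with rays and parabolas near the origin\<close>

abbreviation chi :: real where "chi \<equiv> chi_plus \<tau> \<alpha>"

abbreviation slope :: "real \<Rightarrow> real" where "slope \<equiv> slope_map \<tau> \<alpha>"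

lemma chi_gt_1: "1 < chi"
  using chi_plus_gt_1[OF tau(1) alpha] .

text \<open>Termwise: with \<open>r = u / v\<close>, degree \<open>k\<close> contributes the ratio
  \<open>(1 - r ^ (k - 1)) / (k - 1)\<close> to \<open>(g v - g u) / h v\<close>, which is largest
  for the smallest degree tau.\<close>

lemma field_le_slope:
  assumes "0 < u" "u \<le> v" "v \<le> 1"
  shows "field u v \<le> slope (v / u)"
proof -
  define r where "r = u / v"
  have v: "0 < v" using assms by simp
  have r: "0 \<le> r" "r \<le> 1" "u = r * v" using assms v by (auto simp: r_def)
  have "real (\<tau> - 1) * (g v - g u) \<le> (1 - r ^ (\<tau> - 1)) * h v"
    unfolding g_def h_def sum_subtractf[symmetric] sum_distrib_left
  proof (rule sum_mono)
    fix k assume k: "k \<in> {\<tau>..\<sigma>}"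
    have "real k * c k * v ^ (k - 1) * (real (\<tau> - 1) * (1 - r ^ (k - 1)))
        \<le> real k * c k * v ^ (k - 1) * (real (k - 1) * (1 - r ^ (\<tau> - 1)))"
      using k v r c_nonneg[OF k]
      by (intro mult_left_mono power_difference_ratio) auto
    then show "real (\<tau> - 1) * (real k * c k * v ^ (k - 1) - real k * c k * u ^ (k - 1))
        \<le> (1 - r ^ (\<tau> - 1)) * (real (k - 1) * (real k * c k) * v ^ (k - 1))"
      by (simp add: r(3) power_mult_distrib algebra_simps)
  qed
  then have "(g v - g u) / h v \<le> (1 - r ^ (\<tau> - 1)) / real (\<tau> - 1)"
    using h_pos[OF v] tau by (simp add: pos_divide_le_eq pos_le_divide_eq mult_ac)
  then have "\<alpha> * ((g v - g u) / h v) \<le> \<alpha> * ((1 - r ^ (\<tau> - 1)) / real (\<tau> - 1))"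
    using alpha_pos' by (intro mult_left_mono) auto
  then show ?thesis
    using tau assms by (simp add: field_def slope_map_def[OF tau(1) alpha] m_eq_1 r_def power_divide of_nat_diff)
qed

text \<open>The terms of degree above \<open>\<tau>\<close> lower the slope by at most a multiple of \<open>u\<close>.\<close>

lemma slope_le_field:
  obtains C where "0 \<le> C"
    "\<And>u z. 0 < u \<Longrightarrow> 1 \<le> z \<Longrightarrow> z \<le> chi \<Longrightarrow> z * u \<le> 1 \<Longrightarrow> slope z - C * u \<le> field u (z * u)"
proof -
  define a where "a = real \<tau> * c \<tau>"
  have a: "0 < a" using tau c_pos by (simp add: a_def)
  define n where "n = real \<tau> - 1"
  have n: "1 \<le> n" "real (\<tau> - 1) = n" using tau by (auto simp: n_def)
  \<comment> \<open>Bounds the terms of \<open>h\<close> above degree tau, with the ratio replaced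
    by chi. Since \<open>u\<close> is at most 1, each of them carries at least one more factor
    \<open>u\<close> than the leading term.\<close>
  define R where "R = (\<Sum>k=Suc \<tau>..\<sigma>. real (k - 1) * (real k * c k) * chi ^ (k - 1))"
  have R: "0 \<le> R" unfolding R_def using c_nonneg chi_gt_1 by (intro sum_nonneg) auto
  have split: "(\<Sum>k=\<tau>..\<sigma>. q k) = q \<tau> + (\<Sum>k=Suc \<tau>..\<sigma>. q k)" for q :: "nat \<Rightarrow> real"
    using sum.atLeast_Suc_atMost[OF tau(2)] .
  show ?thesis
  proof
    show "0 \<le> \<alpha> * R / (n * n * a)" using alpha_pos' R n a by simp
    fix u z assume u: "0 < u" and z: "1 \<le> z" "z \<le> chi" and zu: "z * u \<le> 1"
    have "1 * u \<le> z * u" using z u by (intro mult_right_mono) auto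
    then have u1: "u \<le> 1" using zu by linarith
    define p where "p = z ^ (\<tau> - 1)"
    have p: "1 \<le> p" using z by (simp add: p_def)
    have h_le: "h (z * u) \<le> u ^ (\<tau> - 1) * (n * a * p + u * R)"
    proof -
      have "real (k - 1) * (real k * c k) * (z * u) ^ (k - 1)
          \<le> u ^ (\<tau> - 1) * u * (real (k - 1) * (real k * c k) * chi ^ (k - 1))"
        if k: "k \<in> {Suc \<tau>..\<sigma>}" for k
      proof -
        have "u ^ (k - 1) \<le> u ^ Suc (\<tau> - 1)"
          using k u u1 tau by (intro power_decreasing) auto
        then have "(z * u) ^ (k - 1) \<le> chi ^ (k - 1) * u ^ Suc (\<tau> - 1)"
          unfolding power_mult_distrib using z u by (intro mult_mono power_mono) auto
        then have "real (k - 1) * (real k * c k) * (z * u) ^ (k - 1)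
            \<le> real (k - 1) * (real k * c k) * (chi ^ (k - 1) * u ^ Suc (\<tau> - 1))"
          using k c_nonneg[of k] by (intro mult_left_mono) auto
        then show ?thesis by (simp add: mult_ac)
      qed
      then have "(\<Sum>k=Suc \<tau>..\<sigma>. real (k - 1) * (real k * c k) * (z * u) ^ (k - 1))
          \<le> u ^ (\<tau> - 1) * u * R"
        unfolding R_def sum_distrib_left by (rule sum_mono)
      then show ?thesis
        unfolding h_def split by (simp add: n(2)[symmetric] a_def p_def power_mult_distrib algebra_simps)
    qed
    have g_ge: "u ^ (\<tau> - 1) * (a * (p - 1)) \<le> g (z * u) - g u"
    proof -
      have "0 \<le> (\<Sum>k=Suc \<tau>..\<sigma>. real k * c k * (z * u) ^ (k - 1) - real k * c k * u ^ (k - 1))"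
        using c_nonneg u z
        by (intro sum_nonneg) (auto intro!: mult_left_mono power_mono)
      then show ?thesis
        unfolding g_def split
        by (simp add: a_def p_def power_mult_distrib sum_subtractf algebra_simps)
    qed
    define U where "U = u ^ (\<tau> - 1)"
    have U: "0 < U" using u by (simp add: U_def)
    define W where "W = n * a * p"
    have W: "0 < W" "n * a \<le> W" using n a p by (auto simp: W_def)
    define N where "N = a * (p - 1)"
    have N: "0 \<le> N" "n * N \<le> W" using n a p by (auto simp: N_def W_def algebra_simps)
    \<comment> \<open>Enlarging the denominator from \<open>W\<close> to \<open>W + u * R\<close>
      costs \<open>N * u * R / (W * (W + u * R))\<close>. The bounds \<open>1 / n\<close> on
      \<open>N / W\<close> and \<open>n * a\<close> on \<open>W\<close> turn this into the constant
      of the lemma.\<close>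
    have "N / W - R / (n * n * a) * u \<le> N / (W + u * R)"
    proof -
      have pos: "0 < W + u * R" using W R u by (simp add: add_pos_nonneg)
      have "N / W - N / (W + u * R) = (N * (W + u * R) - N * W) / (W * (W + u * R))"
        using W pos by (subst diff_frac_eq) auto
      also have "\<dots> = N * (u * R) / (W * (W + u * R))" by (simp add: algebra_simps)
      also have "\<dots> \<le> N * (u * R) / (W * W)"
      proof (rule divide_left_mono)
        show "W * W \<le> W * (W + u * R)" using W R u by (intro mult_left_mono) auto
      qed (use W R u N pos in auto)
      also have "\<dots> = (N / W) * (u * R) / W" by simp
      also have "\<dots> \<le> (1 / n) * (u * R) / W"
      proof (intro divide_right_mono mult_right_mono)
        show "N / W \<le> 1 / n" using N(2) n W(1) by (simp add: pos_divide_le_eq pos_le_divide_eq mult.commute)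
      qed (use W R u in auto)
      also have "\<dots> \<le> (1 / n) * (u * R) / (n * a)"
        using W n a R u by (intro divide_left_mono) auto
      also have "\<dots> = R / (n * n * a) * u" by (simp add: mult_ac)
      finally show ?thesis by simp
    qed
    also have "N / (W + u * R) = U * N / (U * (W + u * R))" using U by simp
    also have "\<dots> \<le> U * N / h (z * u)"
      using h_le h_pos[of "z * u"] u z U N W unfolding U_def W_def
      by (intro divide_left_mono) auto
    also have "\<dots> \<le> (g (z * u) - g u) / h (z * u)"
      using g_ge h_pos[of "z * u"] u z by (intro divide_right_mono) (auto simp: U_def N_def)
    finally have "\<alpha> * (N / W - R / (n * n * a) * u) \<le> \<alpha> * ((g (z * u) - g u) / h (z * u))"
      using alpha_pos' by (intro mult_left_mono) auto
    moreover have "slope z = \<alpha> * (N / W)"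
    proof -
      have "N / W = (1 - 1 / p) / n"
        using n a p by (simp add: N_def W_def diff_divide_distrib mult_ac)
      then show ?thesis
        unfolding slope_map_def[OF tau(1) alpha] n_def[symmetric] p_def[symmetric] by simp
    qed
    ultimately show "slope z - \<alpha> * R / (n * n * a) * u \<le> field u (z * u)"
      using zu by (simp add: field_def m_eq_1 right_diff_distrib)
  qed
qed

text \<open>At time \<open>u\<close> the parabola has ratio chi - x with x = K u. There the field is
  at least chi - (3/2) K u - C u, while the parabola has slope chi - 2 K u, so K must be at least 2
  C.\<close>

lemma parabola_subsolution:
  obtains K \<delta> where "0 < K" "0 < \<delta>" "chi * \<delta> \<le> 1"
    "\<And>u. 0 < u \<Longrightarrow> u \<le> \<delta> \<Longrightarrow> u \<le> chi * u - K * u\<^sup>2 \<and> chi - 2 * K * u \<le> field u (chi * u - K * u\<^sup>2)"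
proof -
  obtain C where C: "0 \<le> C"
    "\<And>u z. 0 < u \<Longrightarrow> 1 \<le> z \<Longrightarrow> z \<le> chi \<Longrightarrow> z * u \<le> 1 \<Longrightarrow> slope z - C * u \<le> field u (z * u)"
    using slope_le_field by blast
  obtain d where d: "0 < d" "\<And>x. 0 < x \<Longrightarrow> x < d \<Longrightarrow> chi - 3 / 2 * x < slope (chi - x)"
    using slope_map_below_chi[OF tau(1) alpha] by blast
  define K where "K = 2 * C + 1"
  have K: "0 < K" using C by (simp add: K_def)
  \<comment> \<open>The three bounds keep the values at most 1, x within \<open>d / 2\<close> and
    hence strictly below \<open>d\<close>, and the ratio chi - x at least 1.\<close>
  define \<delta> where "\<delta> = Min {1 / chi, d / (2 * K), (chi - 1) / K}"
  have delta: "0 < \<delta>" "\<delta> \<le> 1 / chi" "\<delta> \<le> d / (2 * K)" "\<delta> \<le> (chi - 1) / K"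
    using chi_gt_1 d K by (auto simp: \<delta>_def)
  show ?thesis
  proof
    show "0 < K" "0 < \<delta>" by fact+
    show "chi * \<delta> \<le> 1" using delta(2) chi_gt_1 by (simp add: pos_le_divide_eq mult.commute)
    fix u assume u: "0 < u" "u \<le> \<delta>"
    define x where "x = K * u"
    have "u \<le> d / (2 * K)" "u \<le> (chi - 1) / K" "u \<le> 1 / chi" using u delta by auto
    then have *: "x \<le> d / 2" "x \<le> chi - 1" "chi * u \<le> 1" "0 < x"
      using K u chi_gt_1 by (simp_all add: x_def pos_le_divide_eq mult_ac)
    have eq: "chi * u - K * u\<^sup>2 = (chi - x) * u" by (simp add: x_def algebra_simps power2_eq_square)
    have "1 * u \<le> (chi - x) * u" using * u by (intro mult_right_mono) auto
    moreover have "(chi - x) * u \<le> chi * u" using * u by (intro mult_right_mono) auto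
    then have "(chi - x) * u \<le> 1" using * by linarith
    then have "slope (chi - x) - C * u \<le> field u ((chi - x) * u)"
      using * u by (intro C(2)) auto
    moreover have "chi - 3 / 2 * x < slope (chi - x)" using * d(1) by (intro d(2)) auto
    moreover have "2 * (K * u) = 3 / 2 * x + C * u + u / 2"
      by (simp add: x_def K_def algebra_simps)
    ultimately show "u \<le> chi * u - K * u\<^sup>2 \<and> chi - 2 * K * u \<le> field u (chi * u - K * u\<^sup>2)"
      unfolding eq using u by auto
  qed
qed

definition reserve_solution :: "(real \<Rightarrow> real) \<Rightarrow> real \<Rightarrow> bool" where
  "reserve_solution \<phi> b \<longleftrightarrow> continuous_on {0..b} \<phi> \<and> \<phi> 0 = 0 \<and>
     (\<forall>u\<in>{0<..b}. u \<le> \<phi> u \<and> (\<phi> has_real_derivative field u (\<phi> u)) (at u within {0..b}))"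

text \<open>The supremum \<open>s\<close> of \<open>\<phi> u / u\<close> near \<open>0\<close> satisfies \<open>s \<le> slope s\<close>.\<close>

lemma reserve_solution_le_chi:
  assumes sol: "reserve_solution \<phi> b" and b: "0 < b"
  obtains e where "0 < e" "e \<le> b" "\<And>u. 0 < u \<Longrightarrow> u \<le> e \<Longrightarrow> \<phi> u \<le> chi * u"
proof -
  have cont: "continuous_on {0..b} \<phi>" and phi0: "\<phi> 0 = 0"
    and ge: "\<And>u. 0 < u \<Longrightarrow> u \<le> b \<Longrightarrow> u \<le> \<phi> u"
    and der: "\<And>u. 0 < u \<Longrightarrow> u \<le> b \<Longrightarrow> (\<phi> has_real_derivative field u (\<phi> u)) (at u within {0..b})"
    using sol by (auto simp: reserve_solution_def)
  obtain d where d: "0 < d" "\<And>u. u \<in> {0..b} \<Longrightarrow> \<bar>u\<bar> < d \<Longrightarrow> \<bar>\<phi> u\<bar> < 1"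
    using cont[unfolded continuous_on_iff, THEN bspec, of 0, THEN spec, of 1] b phi0
    unfolding dist_real_def by auto
  define e where "e = min (d / 2) b"
  have e: "0 < e" "e \<le> b" using d b by (auto simp: e_def)
  have le1: "\<phi> u \<le> 1" if "0 < u" "u \<le> e" for u
    using d(2)[of u] d(1) that by (auto simp: e_def)
  \<comment> \<open>The mean value theorem from \<open>0\<close> turns a bound on the field along
    the solution into the same bound on \<open>\<phi> u / u\<close>.\<close>
  have lin: "\<phi> u \<le> M * u" if M: "\<And>z. 0 < z \<Longrightarrow> z \<le> e \<Longrightarrow> field z (\<phi> z) \<le> M" and u: "0 < u" "u \<le> e" for M u
  proof -
    have "\<exists>l z. 0 < z \<and> z < u \<and> (\<phi> has_real_derivative l) (at z) \<and> \<phi> u - \<phi> 0 = (u - 0) * l"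
    proof (rule MVT)
      show "continuous_on {0..u} \<phi>" using u e by (intro continuous_on_subset[OF cont]) auto
      fix z assume "0 < z" "z < u"
      then show "\<phi> differentiable (at z)"
        using der[of z] u e by (auto simp: at_within_Icc_at real_differentiable_def)
    qed (use u in simp)
    then obtain l z where z: "0 < z" "z < u" "(\<phi> has_real_derivative l) (at z)" "\<phi> u = u * l"
      using phi0 by auto
    have "l = field z (\<phi> z)"
      using der[of z] z u e by (auto simp: at_within_Icc_at intro: DERIV_unique)
    then show ?thesis using z M[of z] u by (simp add: mult.commute mult_left_mono)
  qed
  define A where "A = (\<lambda>u. \<phi> u / u) ` {0<..e}"
  \<comment> \<open>A crude first bound makes the supremum finite; the second pass, with
    \<open>slope s\<close> in place of the constant, then sharpens it.\<close>
  have "\<phi> u \<le> \<alpha> / (real \<tau> - 1) * u" if "0 < u" "u \<le> e" for u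
  proof (rule lin[OF _ that])
    fix z assume z: "0 < z" "z \<le> e"
    have "field z (\<phi> z) \<le> slope (\<phi> z / z)" using z ge[of z] le1[of z] e by (intro field_le_slope) auto
    also have "\<dots> \<le> \<alpha> / (real \<tau> - 1)"
      using z ge[of z] e by (intro slope_map_le[OF tau(1) alpha]) auto
    finally show "field z (\<phi> z) \<le> \<alpha> / (real \<tau> - 1)" .
  qed
  then have bdd: "bdd_above A"
    unfolding A_def bdd_above_def
    by (intro exI[of _ "\<alpha> / (real \<tau> - 1)"]) (auto simp: pos_divide_le_eq)
  define s where "s = Sup A"
  have s_ge: "\<phi> u / u \<le> s" if "0 < u" "u \<le> e" for u
    unfolding s_def using that by (intro cSup_upper bdd) (auto simp: A_def)
  have "1 \<le> \<phi> e / e" using ge[of e] e by simp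
  then have s1: "1 \<le> s" using s_ge[of e] e by linarith
  have "\<phi> u \<le> slope s * u" if "0 < u" "u \<le> e" for u
  proof (rule lin[OF _ that])
    fix z assume z: "0 < z" "z \<le> e"
    have "field z (\<phi> z) \<le> slope (\<phi> z / z)" using z ge[of z] le1[of z] e by (intro field_le_slope) auto
    also have "\<dots> \<le> slope s"
      using z ge[of z] s_ge[of z] e by (intro slope_map_mono[OF tau(1) alpha]) auto
    finally show "field z (\<phi> z) \<le> slope s" .
  qed
  then have "s \<le> slope s"
    unfolding s_def A_def using e by (intro cSup_least) (auto simp: divide_le_eq)
  then have "s \<le> chi" using s1 by (intro le_slope_map_imp_le_chi[OF tau(1) alpha]) auto
  show ?thesis
  proof
    fix u assume u: "0 < u" "u \<le> e"
    then have "\<phi> u / u \<le> chi" using s_ge[of u] \<open>s \<le> chi\<close> by simp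
    then show "\<phi> u \<le> chi * u" using u by (simp add: divide_le_eq)
  qed fact+
qed

abbreviation clamped_solution :: "(real \<Rightarrow> real) \<Rightarrow> bool" where
  "clamped_solution x \<equiv> clamped.solves_on x {0<..}"

lemma clamped_solution_deriv:
  assumes "clamped_solution x" "0 < t"
  shows "(x has_real_derivative clamped t (x t)) (at t within S)"
proof -
  have "at t within {0<..} = at t"
    by (rule at_within_open[OF _ open_greaterThan]) (use assms in simp)
  then have "(x has_real_derivative clamped t (x t)) (at t)"
    using assms unfolding clamped.solves_on_def by (metis greaterThan_iff)
  then show ?thesis by (rule has_field_derivative_at_within)
qed

text \<open>On the ray of ratio chi the field is at most \<open>slope chi = chi\<close>, the
  derivative of the ray, so no solution crosses it upwards. The condition
  \<open>chi * t \<le> 1\<close> keeps the ray where \<open>m\<close> equals 1.\<close>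

lemma clamped_solution_le_chi:
  assumes x: "clamped_solution x" and st: "0 < s" "s \<le> t" "chi * t \<le> 1" and le: "x s \<le> chi * s"
  shows "x t \<le> chi * t"
proof (rule clamped.compare_forward[where x = x and z = "\<lambda>t. chi * t" and dz = "\<lambda>_. chi"
      and dx = "\<lambda>t. clamped t (x t)" and a = s and b = t])
  fix r assume r: "r \<in> {s..t}"
  then have r0: "0 < r" using st by simp
  show "(x has_real_derivative clamped r (x r)) (at r within {s..t})"
    using x r0 by (rule clamped_solution_deriv)
  show "((\<lambda>t. chi * t) has_real_derivative chi) (at r within {s..t})"
    by (auto intro!: derivative_eq_intros)
  have "r \<le> chi * r" using chi_gt_1 r0 by simp
  moreover have "chi * r \<le> 1" using r st chi_gt_1
    by (intro order_trans[OF mult_left_mono[of r t chi]]) auto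
  ultimately have "field r (chi * r) \<le> slope (chi * r / r)" using r0 by (intro field_le_slope)
  then show "clamped r (chi * r) \<le> chi"
    using r0 \<open>r \<le> chi * r\<close> slope_map_chi[OF tau(1) alpha] by (simp add: clamped_eq)
qed (use st le in auto)

section \<open>The maximal solution\<close>

text \<open>No bound from below is imposed, so negative constants qualify as well; only the supremum
  of this class is of interest.\<close>

definition starts_below_chi :: "(real \<Rightarrow> real) \<Rightarrow> bool" where
  "starts_below_chi x \<longleftrightarrow> clamped_solution x \<and> (\<exists>e>0. \<forall>u\<in>{0<..e}. x u \<le> chi * u)"

lemma starts_below_chiD:
  assumes "starts_below_chi x" "0 < u" "chi * u \<le> 1"
  shows "x u \<le> chi * u"
proof -
  obtain e where x: "clamped_solution x" and e: "0 < e" "\<And>u. 0 < u \<Longrightarrow> u \<le> e \<Longrightarrow> x u \<le> chi * u"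
    using assms(1) by (auto simp: starts_below_chi_def)
  show ?thesis
    by (rule clamped_solution_le_chi[OF x, of "min e u"]) (use e assms in auto)
qed

text \<open>As solutions do not cross, the largest one is found at the single time
  \<open>\<delta>\<close>: its value there is the supremum over the class. A solution started on the
  parabola lies below it at earlier times, hence belongs to the class and pushes the maximum above
  the parabola.\<close>

lemma exists_maximal:
  "\<exists>x. x 0 = 0 \<and> clamped_solution x \<and>
     (\<exists>K \<delta>. 0 < \<delta> \<and> (\<forall>u\<in>{0<..\<delta>}. u \<le> x u \<and> chi * u - K * u\<^sup>2 \<le> x u \<and> x u \<le> chi * u)) \<and>
     (\<forall>z. starts_below_chi z \<longrightarrow> (\<forall>t>0. z t \<le> x t))"
proof -
  obtain K \<delta> where K: "0 < K" "0 < \<delta>" "chi * \<delta> \<le> 1"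
    and low: "\<And>u. 0 < u \<Longrightarrow> u \<le> \<delta> \<Longrightarrow> u \<le> chi * u - K * u\<^sup>2 \<and> chi - 2 * K * u \<le> field u (chi * u - K * u\<^sup>2)"
    using parabola_subsolution by blast
  have chi_u: "chi * u \<le> 1" if "u \<le> \<delta>" for u
    using that K(3) chi_gt_1 by (intro order_trans[OF mult_left_mono[of u \<delta> chi]]) auto
  have parabola: "\<exists>z. starts_below_chi z \<and> z s = chi * s - K * s\<^sup>2" if s: "0 < s" "s \<le> \<delta>" for s
  proof -
    obtain z where z: "z s = chi * s - K * s\<^sup>2" "clamped_solution z"
      using clamped.exists_solution[OF s(1)] by blast
    have "z u \<le> chi * u - K * u\<^sup>2" if u: "0 < u" "u \<le> s" for u
    proof (rule clamped.compare_backward[where x = z and z = "\<lambda>u. chi * u - K * u\<^sup>2"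
          and dz = "\<lambda>u. chi - 2 * K * u" and dx = "\<lambda>t. clamped t (z t)" and a = u and b = s])
      fix r assume r: "r \<in> {u..s}"
      show "(z has_real_derivative clamped r (z r)) (at r within {u..s})"
        using z r u by (intro clamped_solution_deriv) auto
      show "((\<lambda>u. chi * u - K * u\<^sup>2) has_real_derivative chi - 2 * K * r) (at r within {u..s})"
        by (auto intro!: derivative_eq_intros)
      show "chi - 2 * K * r \<le> clamped r (chi * r - K * r\<^sup>2)"
        using low[of r] r u s by (simp add: clamped_eq)
    qed (use u z in auto)
    moreover have "chi * u - K * u\<^sup>2 \<le> chi * u" for u using K by simp
    ultimately have "\<forall>u\<in>{0<..s}. z u \<le> chi * u"
      by (metis greaterThanAtMost_iff order_trans)
    then show ?thesis using z s by (auto simp: starts_below_chi_def)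
  qed
  define A where "A = {z \<delta> | z. starts_below_chi z}"
  have "A \<noteq> {}" using parabola[of \<delta>] K by (auto simp: A_def)
  have bdd: "bdd_above A"
    unfolding A_def bdd_above_def
    using starts_below_chiD K by (intro exI[of _ "chi * \<delta>"]) auto
  obtain x where x: "x \<delta> = Sup A" "clamped_solution x"
    using clamped.exists_solution[OF K(2)] by blast
  have max: "z t \<le> x t" if z: "starts_below_chi z" and t: "0 < t" for z t
  proof (rule clamped.solves_le[of z x \<delta> t])
    show "clamped_solution z" using z by (simp add: starts_below_chi_def)
    show "z \<delta> \<le> x \<delta>" unfolding x(1)
      by (rule cSup_upper[OF _ bdd]) (use z in \<open>auto simp: A_def\<close>)
  qed (use x t K in auto)
  \<comment> \<open>If \<open>x\<close> exceeded the ray at \<open>u\<close>, the solution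
    \<open>y\<close> through the ray there would lie below \<open>x\<close> at
    \<open>\<delta>\<close>. By the supremum some member of the class would lie above
    \<open>y\<close>, hence above the ray at \<open>u\<close>.\<close>
  have le: "x u \<le> chi * u" if u: "0 < u" "u \<le> \<delta>" for u
  proof (rule ccontr)
    assume "\<not> x u \<le> chi * u"
    obtain y where y: "y u = chi * u" "clamped_solution y"
      using clamped.exists_solution[OF u(1)] by blast
    then have "y \<delta> < x \<delta>"
      using clamped.solves_less[OF y(2) x(2) u(1) K(2)] \<open>\<not> x u \<le> chi * u\<close> by simp
    then obtain z where z: "starts_below_chi z" "y \<delta> < z \<delta>"
      unfolding x(1) less_cSup_iff[OF \<open>A \<noteq> {}\<close> bdd] by (auto simp: A_def)
    then have "y u < z u"
      using clamped.solves_less[OF y(2) _ K(2) u(1), of z] by (simp add: starts_below_chi_def)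
    moreover have "z u \<le> chi * u" using starts_below_chiD[OF z(1) u(1) chi_u[OF u(2)]] .
    ultimately show False using y by simp
  qed
  have ge: "chi * u - K * u\<^sup>2 \<le> x u" if u: "0 < u" "u \<le> \<delta>" for u
    using parabola[OF u] max[OF _ u(1)] by metis
  \<comment> \<open>Solutions on the positive reals carry an arbitrary value at \<open>0\<close>; it
    is reset to the limit given by the squeeze.\<close>
  define x' where "x' = (\<lambda>t. if t = 0 then 0 else x t)"
  have x': "x' t = x t" if "0 < t" for t using that by (simp add: x'_def)
  have "clamped_solution x'"
    unfolding clamped.solves_on_def
  proof
    fix t :: real assume t: "t \<in> {0<..}"
    then have "(x has_real_derivative clamped t (x' t)) (at t within {0<..})"
      using clamped_solution_deriv[OF x(2)] by (simp add: x'_def)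
    then show "(x' has_real_derivative clamped t (x' t)) (at t within {0<..})"
      by (rule has_field_derivative_transform_within[of _ _ _ _ 1]) (use t in \<open>auto simp: x'_def\<close>)
  qed
  moreover have "\<forall>u\<in>{0<..\<delta>}. u \<le> x' u \<and> chi * u - K * u\<^sup>2 \<le> x' u \<and> x' u \<le> chi * u"
  proof
    fix u assume "u \<in> {0<..\<delta>}"
    then have u: "0 < u" "u \<le> \<delta>" by auto
    show "u \<le> x' u \<and> chi * u - K * u\<^sup>2 \<le> x' u \<and> x' u \<le> chi * u"
      using low[OF u] le[OF u] ge[OF u] by (simp add: x'[OF u(1)])
  qed
  moreover have "\<forall>z. starts_below_chi z \<longrightarrow> (\<forall>t>0. z t \<le> x' t)"
    using max x' by simp
  moreover have "x' 0 = 0" by (simp add: x'_def)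
  ultimately show ?thesis using K(2) by blast
qed

definition Phi :: "real \<Rightarrow> real" where
  "Phi = (SOME x. x 0 = 0 \<and> clamped_solution x \<and>
     (\<exists>K \<delta>. 0 < \<delta> \<and> (\<forall>u\<in>{0<..\<delta>}. u \<le> x u \<and> chi * u - K * u\<^sup>2 \<le> x u \<and> x u \<le> chi * u)) \<and>
     (\<forall>z. starts_below_chi z \<longrightarrow> (\<forall>t>0. z t \<le> x t)))"

lemma Phi_0: "Phi 0 = 0" and Phi_solution: "clamped_solution Phi"
  and Phi_near_0: "\<exists>K \<delta>. 0 < \<delta> \<and>
    (\<forall>u\<in>{0<..\<delta>}. u \<le> Phi u \<and> chi * u - K * u\<^sup>2 \<le> Phi u \<and> Phi u \<le> chi * u)"
  and Phi_maximal: "starts_below_chi z \<Longrightarrow> 0 < t \<Longrightarrow> z t \<le> Phi t"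
  using someI_ex[OF exists_maximal] unfolding Phi_def[symmetric] by auto

lemma Phi_deriv: "0 < t \<Longrightarrow> (Phi has_real_derivative clamped t (Phi t)) (at t within S)"
  by (rule clamped_solution_deriv[OF Phi_solution])

lemma Phi_deriv_0: "(Phi has_real_derivative chi) (at 0 within {0..y})"
proof -
  obtain K \<delta> where \<delta>: "0 < \<delta>"
    and "\<forall>u\<in>{0<..\<delta>}. u \<le> Phi u \<and> chi * u - K * u\<^sup>2 \<le> Phi u \<and> Phi u \<le> chi * u"
    using Phi_near_0 by blast
  then have K: "chi * u - K * u\<^sup>2 \<le> Phi u \<and> Phi u \<le> chi * u" if "0 < u" "u \<le> \<delta>" for u
    using that by simp
  have ev: "eventually (\<lambda>u. 0 < u \<and> u \<le> \<delta>) (at 0 within {0..y})"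
    unfolding eventually_at using \<delta> by (intro exI[of _ \<delta>]) (auto simp: dist_real_def)
  have "((\<lambda>u. Phi u / u) \<longlongrightarrow> chi) (at 0 within {0..y})"
  proof (rule tendsto_sandwich)
    show "eventually (\<lambda>u. chi - K * u \<le> Phi u / u) (at 0 within {0..y})"
      using ev
    proof eventually_elim
      case (elim u)
      then show ?case using K[of u] by (simp add: pos_le_divide_eq left_diff_distrib power2_eq_square)
    qed
    show "eventually (\<lambda>u. Phi u / u \<le> chi) (at 0 within {0..y})"
      using ev
    proof eventually_elim
      case (elim u)
      then show ?case using K[of u] by (simp add: pos_divide_le_eq)
    qed
    have "((\<lambda>u. chi - K * u) \<longlongrightarrow> chi - K * 0) (at 0 within {0..y})"
      by (intro tendsto_intros)
    then show "((\<lambda>u. chi - K * u) \<longlongrightarrow> chi) (at 0 within {0..y})" by simp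
  qed simp
  then show ?thesis by (simp add: has_field_derivative_iff Phi_0)
qed

lemma continuous_on_Phi: "continuous_on {0..b} Phi"
proof (rule DERIV_continuous_on)
  fix t assume "t \<in> {0..b}"
  then show "(Phi has_real_derivative (if t = 0 then chi else clamped t (Phi t))) (at t within {0..b})"
    using Phi_deriv_0 Phi_deriv[of t] by auto
qed

text \<open>The diagonal has slope 1 while the field on it vanishes, so solutions can cross it only
  downwards in time.\<close>

lemma clamped_solution_above_diagonal:
  assumes x: "clamped_solution x" and "0 < u" "u \<le> y" "y \<le> x y"
  shows "u \<le> x u"
proof (rule clamped.compare_backward[where x = "\<lambda>u. u" and dx = "\<lambda>_. 1" and z = x
      and dz = "\<lambda>t. clamped t (x t)" and a = u and b = y])
  fix r assume r: "r \<in> {u..y}"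
  show "(x has_real_derivative clamped r (x r)) (at r within {u..y})"
    using r assms by (intro clamped_solution_deriv) auto
qed (use assms in \<open>auto simp: clamped_below\<close>)

text \<open>Below the diagonal the clamped equation only has constant solutions.\<close>

lemma Phi_above_diagonal_strict:
  assumes "0 < u" "u < y" "y \<le> Phi y"
  shows "u < Phi u"
proof (rule ccontr)
  assume "\<not> u < Phi u"
  then have "Phi u \<le> u" by simp
  have "Phi y \<le> u"
  proof (rule clamped.compare_forward[where x = Phi and dx = "\<lambda>t. clamped t (Phi t)"
        and z = "\<lambda>_. u" and dz = "\<lambda>_. 0" and a = u and b = y])
    fix r assume r: "r \<in> {u..y}"
    show "(Phi has_real_derivative clamped r (Phi r)) (at r within {u..y})"
      using r assms by (intro Phi_deriv) auto
    show "clamped r u \<le> 0" using r by (simp add: clamped_below)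
  qed (use assms \<open>Phi u \<le> u\<close> in auto)
  then show False using assms by simp
qed

lemma Phi_above_diagonal:
  assumes "0 \<le> u" "u \<le> y" "y \<le> Phi y" shows "u \<le> Phi u"
proof -
  consider "u = 0" | "u = y" | "0 < u" "u < y" using assms by linarith
  then show ?thesis
    by cases (use assms Phi_0 Phi_above_diagonal_strict[of u y] in auto)
qed

lemma Phi_mono: assumes "0 < s" "s \<le> t" shows "Phi s \<le> Phi t"
proof (rule DERIV_nonneg_imp_increasing_open[OF assms(2)])
  fix r assume "s < r" "r < t"
  then show "\<exists>d. (Phi has_real_derivative d) (at r) \<and> 0 \<le> d"
    using Phi_deriv[of r UNIV] clamped_nonneg[of r] assms by auto
qed (use assms in \<open>auto intro!: continuous_on_subset[OF continuous_on_Phi[of t]]\<close>)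

lemma Phi_strict_mono: assumes "0 < s" "s < t" "t \<le> Phi t" shows "Phi s < Phi t"
proof (rule DERIV_pos_imp_increasing_open[OF assms(2)])
  fix r assume r: "s < r" "r < t"
  then have "r < Phi r" using assms by (intro Phi_above_diagonal_strict[of r t]) auto
  then show "\<exists>d. (Phi has_real_derivative d) (at r) \<and> 0 < d"
    using Phi_deriv[of r UNIV] field_pos[of r "Phi r"] r assms
    by (auto simp: clamped_eq)
qed (use assms in \<open>auto intro!: continuous_on_subset[OF continuous_on_Phi[of t]]\<close>)

section \<open>Reserve solutions compared with the maximal solution\<close>

lemma reserve_solution_clamped:
  assumes "reserve_solution \<phi> b" "0 < a"
  shows "clamped.solves_on \<phi> {a..b}"
  unfolding clamped.solves_on_def
proof
  fix t assume t: "t \<in> {a..b}"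
  then have "t \<le> \<phi> t" "(\<phi> has_real_derivative field t (\<phi> t)) (at t within {0..b})"
    using assms by (auto simp: reserve_solution_def)
  then show "(\<phi> has_real_derivative clamped t (\<phi> t)) (at t within {a..b})"
    using assms t by (auto simp: clamped_eq intro: DERIV_subset)
qed

text \<open>No derivative at \<open>0\<close> is prescribed for the solution:
  \<open>reserve_solution_le_chi\<close> places it below the ray. Since \<open>Phi_maximal\<close>
  concerns solutions on all positive times, the solution is first continued by a clamped
  one.\<close>

lemma reserve_solution_le_Phi:
  assumes sol: "reserve_solution \<phi> b" and u: "0 \<le> u" "u \<le> b"
  shows "\<phi> u \<le> Phi u"
proof (cases "u = 0")
  case True
  then show ?thesis using sol by (simp add: reserve_solution_def Phi_0)
next
  case False
  then have u0: "0 < u" and b: "0 < b" using u by auto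
  obtain e where e: "0 < e" "e \<le> b" "\<And>u. 0 < u \<Longrightarrow> u \<le> e \<Longrightarrow> \<phi> u \<le> chi * u"
    using reserve_solution_le_chi[OF sol b] by blast
  obtain x where x: "x e = \<phi> e" "clamped_solution x"
    using clamped.exists_solution[OF e(1)] by blast
  have eq: "x t = \<phi> t" if t: "0 < t" "t \<le> b" for t
  proof (rule clamped.solves_on_unique[where x = x and z = \<phi> and a = "min t e" and b = b and s = e and t = t])
    show "clamped.solves_on \<phi> {min t e..b}"
      by (rule reserve_solution_clamped[OF sol]) (use t e in auto)
    show "clamped.solves_on x {min t e..b}"
      by (rule clamped.solves_on_subset[OF x(2)]) (use t e in auto)
  qed (use t e x in auto)
  have "starts_below_chi x"
    unfolding starts_below_chi_def using x(2) e eq by (intro conjI exI[of _ e]) auto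
  from Phi_maximal[OF this u0] show ?thesis using eq[OF u0 u(2)] by simp
qed

text \<open>The squeeze between \<open>0\<close> and \<open>Phi\<close> supplies continuity at
  \<open>0\<close>; being on or above the diagonal at \<open>b\<close> carries over to all earlier
  times, where clamping is then inactive.\<close>

lemma reserve_solution_below_Phi:
  assumes x: "clamped_solution x" and b: "0 < b" "b \<le> x b" "x b \<le> Phi b"
  shows "reserve_solution (\<lambda>u. if u = 0 then 0 else x u) b"
proof -
  let ?x = "\<lambda>u. if u = 0 then 0 else x u"
  have ge: "u \<le> x u" if "0 < u" "u \<le> b" for u
    using clamped_solution_above_diagonal[OF x that b(2)] .
  have le: "x u \<le> Phi u" if "0 < u" for u
    using clamped.solves_le[OF x Phi_solution b(1) that b(3)] .
  have der: "(?x has_real_derivative field u (x u)) (at u within {0..b})" if u: "0 < u" "u \<le> b" for u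
  proof -
    have "(x has_real_derivative field u (x u)) (at u)"
      using clamped_solution_deriv[OF x u(1)] ge[OF u] by (simp add: clamped_eq)
    then have "(?x has_real_derivative field u (x u)) (at u)"
      by (rule has_field_derivative_transform_within_open[of _ _ _ "{0<..}"]) (use u in auto)
    then show ?thesis by (rule has_field_derivative_at_within)
  qed
  have "(?x \<longlongrightarrow> ?x 0) (at 0 within {0..b})"
  proof (rule tendsto_sandwich)
    have ev: "eventually (\<lambda>u. u \<in> {0..b} \<and> u \<noteq> 0) (at 0 within {0..b})"
      by (simp add: eventually_at_filter)
    show "eventually (\<lambda>u. 0 \<le> ?x u) (at 0 within {0..b})"
      using ev
    proof eventually_elim
      case (elim u)
      then show ?case using ge[of u] by auto
    qed
    show "eventually (\<lambda>u. ?x u \<le> Phi u) (at 0 within {0..b})"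
      using ev
    proof eventually_elim
      case (elim u)
      then show ?case using le[of u] by auto
    qed
    show "(Phi \<longlongrightarrow> ?x 0) (at 0 within {0..b})"
      using continuous_on_Phi[of b, unfolded continuous_on_def, THEN bspec, of 0] b by (simp add: Phi_0)
  qed simp
  then have at_0: "continuous (at 0 within {0..b}) ?x" by (simp only: continuous_within)
  have "continuous_on {0..b} ?x"
    unfolding continuous_on_eq_continuous_within
  proof
    fix u assume "u \<in> {0..b}"
    then consider "u = 0" | "0 < u" "u \<le> b" by fastforce
    then show "continuous (at u within {0..b}) ?x"
      by cases (use at_0 DERIV_continuous[OF der] in blast)+
  qed
  then show ?thesis
    unfolding reserve_solution_def
  proof (intro conjI ballI)
    fix u assume "u \<in> {0<..b}"
    then have u: "0 < u" "u \<le> b" by auto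
    show "u \<le> ?x u" using ge[OF u] u by simp
    show "(?x has_real_derivative field u (?x u)) (at u within {0..b})" using der[OF u] u by simp
  qed simp_all
qed

lemma reserve_solution_Phi_iff:
  assumes "0 < y"
  shows "reserve_solution Phi y \<longleftrightarrow> y \<le> Phi y"
proof
  assume "y \<le> Phi y"
  moreover have "(\<lambda>u. if u = 0 then 0 else Phi u) = Phi" by (auto simp: Phi_0)
  ultimately show "reserve_solution Phi y"
    using reserve_solution_below_Phi[OF Phi_solution assms] by simp
qed (use assms in \<open>auto simp: reserve_solution_def\<close>)

lemma reserve_solution_imp_Phi:
  assumes "reserve_solution \<phi> y" "0 < y"
  shows "y \<le> Phi y"
proof -
  have "y \<le> \<phi> y" using assms by (simp add: reserve_solution_def)
  also have "\<dots> \<le> Phi y" using assms by (intro reserve_solution_le_Phi) auto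
  finally show ?thesis .
qed

lemma reserve_solution_cong:
  assumes sol: "reserve_solution \<phi> b" and b: "0 < b" and eq: "\<And>u. u \<in> {0..b} \<Longrightarrow> \<phi> u = \<psi> u"
  shows "reserve_solution \<psi> b"
  unfolding reserve_solution_def
proof (intro conjI ballI)
  have "continuous_on {0..b} \<phi>" using sol by (simp add: reserve_solution_def)
  then show "continuous_on {0..b} \<psi>" by (rule continuous_on_eq) (rule eq)
  show "\<psi> 0 = 0" using sol eq[of 0] b by (simp add: reserve_solution_def)
  fix u assume u: "u \<in> {0<..b}"
  then have u': "u \<in> {0..b}" by simp
  have "u \<le> \<phi> u" using sol u by (simp add: reserve_solution_def)
  then show "u \<le> \<psi> u" using eq[OF u'] by simp
  have "(\<phi> has_real_derivative field u (\<phi> u)) (at u within {0..b})"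
    using sol u by (simp add: reserve_solution_def)
  then have "(\<phi> has_real_derivative field u (\<psi> u)) (at u within {0..b})"
    using eq[OF u'] by simp
  then show "(\<psi> has_real_derivative field u (\<psi> u)) (at u within {0..b})"
    by (rule has_field_derivative_transform_within[of _ _ _ _ 1]) (use u' eq in auto)
qed

text \<open>Needed for continuations, which are assumed positive but not above the diagonal, so the
  clamped comparison is out of reach. Compactness gives a positive lower bound for both functions,
  hence a Lipschitz constant.\<close>

lemma positive_solution_le:
  assumes a: "0 < a" "a \<le> b"
    and x: "\<And>t. t \<in> {a..b} \<Longrightarrow> 0 < x t \<and> (x has_real_derivative field t (x t)) (at t within {a..b})"
    and z: "\<And>t. t \<in> {a..b} \<Longrightarrow> 0 < z t \<and> (z has_real_derivative field t (z t)) (at t within {a..b})"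
    and init: "x a \<le> z a"
  shows "x b \<le> z b"
proof -
  have cx: "continuous_on {a..b} x" by (rule DERIV_continuous_on) (rule x[THEN conjunct2])
  have cz: "continuous_on {a..b} z" by (rule DERIV_continuous_on) (rule z[THEN conjunct2])
  have ab: "compact {a..b}" "{a..b} \<noteq> {}" using a by auto
  obtain p where p: "p \<in> {a..b}" "\<forall>t\<in>{a..b}. x p \<le> x t"
    using continuous_attains_inf[OF ab cx] by blast
  obtain q where q: "q \<in> {a..b}" "\<forall>t\<in>{a..b}. z q \<le> z t"
    using continuous_attains_inf[OF ab cz] by blast
  define lo where "lo = min (x p) (z q)"
  have lo: "0 < lo" using x[OF p(1)] z[OF q(1)] by (simp add: lo_def)
  obtain L where L: "0 \<le> L" "\<And>u v w. 0 < u \<Longrightarrow> u \<le> b \<Longrightarrow> lo \<le> v \<Longrightarrow> lo \<le> w \<Longrightarrow>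
      \<bar>field u v - field u w\<bar> \<le> L * \<bar>v - w\<bar>"
    using field_lipschitz[OF lo, of b] by blast
  have "x b - z b \<le> 0"
  proof (rule diff_ineq_forward[where D = "\<lambda>t. x t - z t" and D' = "\<lambda>t. field t (x t) - field t (z t)"
        and L = L and a = a and b = b])
    fix t assume t: "t \<in> {a..b}"
    show "((\<lambda>t. x t - z t) has_real_derivative field t (x t) - field t (z t)) (at t within {a..b})"
      by (rule DERIV_diff[OF x[OF t, THEN conjunct2] z[OF t, THEN conjunct2]])
    assume "0 < x t - z t"
    moreover have "lo \<le> x t" "lo \<le> z t" using p(2) q(2) t by (auto simp: lo_def min_le_iff_disj)
    then have "\<bar>field t (x t) - field t (z t)\<bar> \<le> L * \<bar>x t - z t\<bar>" using t a by (intro L(2)) auto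
    ultimately show "field t (x t) - field t (z t) \<le> L * (x t - z t)" by simp
  qed (use a init in auto)
  then show ?thesis by simp
qed

end

section \<open>Upper-bound solutions and the maximal utilization level\<close>

locale cost_function =
  fixes \<tau> \<sigma> :: nat and c :: "nat \<Rightarrow> real" and \<alpha> :: real and f :: "real poly"
  assumes tau: "2 \<le> \<tau>" "\<tau> \<le> \<sigma>"
    and c_nonneg: "\<And>k. k \<in> {\<tau>..\<sigma>} \<Longrightarrow> 0 \<le> c k" and c_pos: "0 < c \<tau>"
    and alpha: "alpha_star \<tau> \<le> \<alpha>"
    and f_eq: "f = (\<Sum>k=\<tau>..\<sigma>. monom (c k) k)"
begin

section \<open>The unlimited (\<open>U\<close>) and limited (\<open>L\<close>) equations of one cost
  polynomial\<close>

sublocale U: reserve_equation \<tau> \<sigma> c \<alpha> "\<lambda>_. 1"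
  by unfold_locales (use tau c_nonneg c_pos alpha in auto)

sublocale L: reserve_equation \<tau> \<sigma> c \<alpha> "max 1"
  by unfold_locales (use tau c_nonneg c_pos alpha in auto)

lemma pderiv_sum: "pderiv (sum q A) = (\<Sum>x\<in>A. pderiv (q x))"
  using higher_pderiv_sum[of 1 q A] by simp

lemma poly_pderiv: "poly (pderiv f) v = U.g v"
  by (simp add: f_eq pderiv_sum pderiv_monom poly_sum poly_monom U.g_def)

lemma poly_pderiv2: "v * poly (pderiv (pderiv f)) v = U.h v"
proof -
  have "v * (real (k - 1) * (real k * c k) * v ^ (k - 1 - 1)) = real (k - 1) * (real k * c k) * v ^ (k - 1)"
    if "k \<in> {\<tau>..\<sigma>}" for k
  proof -
    have "v ^ (k - 1) = v * v ^ (k - 1 - 1)" using that tau by (simp add: power_eq_if)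
    then show ?thesis by simp
  qed
  then have "(\<Sum>k=\<tau>..\<sigma>. v * (real (k - 1) * (real k * c k) * v ^ (k - 1 - 1))) = U.h v"
    unfolding U.h_def by (intro sum.cong) auto
  then show ?thesis
    by (simp add: f_eq pderiv_sum pderiv_monom poly_sum poly_monom sum_distrib_left)
qed

lemma unlimited_rhs_eq: "unlimited_rhs f \<alpha> y v = U.field y v"
  by (simp add: unlimited_rhs_def U.field_def poly_pderiv poly_pderiv2)

lemma limited_rhs_eq:
  assumes "0 < v" shows "limited_rhs f \<alpha> y v = L.field y v"
proof -
  have "min v 1 * poly (pderiv (pderiv f)) v = v * poly (pderiv (pderiv f)) v / max 1 v"
    using assms by (simp add: min_def max_def)
  then show ?thesis
    by (simp add: limited_rhs_def L.field_def poly_pderiv poly_pderiv2)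
qed

lemma field_eq: "v \<le> 1 \<Longrightarrow> U.field u v = L.field u v"
  by (simp add: U.field_def L.field_def max_def)

lemma reserve_solution_eq:
  assumes "\<And>u. u \<in> {0<..b} \<Longrightarrow> \<phi> u \<le> 1"
  shows "U.reserve_solution \<phi> b \<longleftrightarrow> L.reserve_solution \<phi> b"
  unfolding U.reserve_solution_def L.reserve_solution_def
  using field_eq assms by (auto cong: ball_cong)

lemma ub_admissible_iff:
  "ub_admissible f \<tau> \<alpha> y \<phi> \<longleftrightarrow>
     U.reserve_solution \<phi> y \<and> (\<phi> has_real_derivative chi_plus \<tau> \<alpha>) (at 0 within {0..y})"
  unfolding ub_admissible_def U.reserve_solution_def unlimited_rhs_eq by blast

lemma ub_admissible_Phi:
  assumes "0 \<le> y" "y \<le> U.Phi y" shows "ub_admissible f \<tau> \<alpha> y U.Phi"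
proof -
  have "U.reserve_solution U.Phi y"
    using assms U.reserve_solution_Phi_iff[of y] U.Phi_0
    by (cases "y = 0") (auto simp: U.reserve_solution_def)
  then show ?thesis using U.Phi_deriv_0 by (simp add: ub_admissible_iff)
qed

text \<open>Every admissible function lies below \<open>U.Phi\<close>, and \<open>U.Phi\<close>
  itself is admissible as long as it stays on or above the diagonal.\<close>

lemma ub_domain_eq: "ub_domain f \<tau> \<alpha> = {y. 0 \<le> y \<and> y \<le> U.Phi y}"
proof -
  have "y \<le> U.Phi y" if "0 \<le> y" "ub_admissible f \<tau> \<alpha> y \<phi>" for y \<phi>
    using that U.reserve_solution_imp_Phi[of \<phi> y] U.Phi_0
    by (cases "y = 0") (auto simp: ub_admissible_iff)
  then show ?thesis using ub_admissible_Phi unfolding ub_domain_def by blast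
qed

lemma phi_ub_eq:
  assumes "y \<in> ub_domain f \<tau> \<alpha>" shows "phi_ub f \<tau> \<alpha> y = U.Phi y"
proof -
  have y: "0 \<le> y" "y \<le> U.Phi y" using assms by (auto simp: ub_domain_eq)
  show ?thesis
    unfolding phi_ub_def
  proof (rule cSup_eq_maximum)
    show "U.Phi y \<in> (\<lambda>\<phi>. \<phi> y) ` {\<phi>. ub_admissible f \<tau> \<alpha> y \<phi>}"
      using ub_admissible_Phi[OF y] by blast
    fix v assume "v \<in> (\<lambda>\<phi>. \<phi> y) ` {\<phi>. ub_admissible f \<tau> \<alpha> y \<phi>}"
    then show "v \<le> U.Phi y"
      using U.reserve_solution_le_Phi y by (auto simp: ub_admissible_iff)
  qed
qed

text \<open>The fields coincide for values at most 1, so \<open>U.Phi\<close> also solves the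
  limited equation and lies below \<open>L.Phi\<close>. Conversely \<open>L.Phi\<close> is known to
  be at most 1 only near \<open>0\<close>; equality holds there and spreads by uniqueness.\<close>

lemma Phi_agree:
  assumes y: "0 \<le> y" "y \<le> U.Phi y" "U.Phi y \<le> 1" and t: "0 \<le> t" "t \<le> y"
  shows "L.Phi t = U.Phi t"
proof (cases "t = 0")
  case True
  then show ?thesis by (simp add: U.Phi_0 L.Phi_0)
next
  case False
  then have t0: "0 < t" and y0: "0 < y" using t by auto
  have "U.reserve_solution U.Phi y" using U.reserve_solution_Phi_iff[OF y0] y by simp
  moreover have "U.Phi u \<le> 1" if "u \<in> {0<..y}" for u
    using U.Phi_mono[of u y] that y by auto
  ultimately have solU: "L.reserve_solution U.Phi y" using reserve_solution_eq by blast
  have le: "U.Phi u \<le> L.Phi u" if "0 \<le> u" "u \<le> y" for u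
    using L.reserve_solution_le_Phi[OF solU that] .
  have "y \<le> L.Phi y" using le[of y] y by simp
  then have solL: "L.reserve_solution L.Phi y" using L.reserve_solution_Phi_iff[OF y0] by simp
  obtain e where e: "0 < e" "e \<le> y" "\<And>u. 0 < u \<Longrightarrow> u \<le> e \<Longrightarrow> L.Phi u \<le> L.chi * u"
    using L.reserve_solution_le_chi[OF solL y0] by blast
  define d where "d = min t (min e (1 / L.chi))"
  have d: "0 < d" "d \<le> t" "d \<le> e" "d \<le> 1 / L.chi" using t0 e L.chi_gt_1 by (auto simp: d_def)
  have "L.Phi d \<le> L.chi * d" using e d by simp
  also have "\<dots> \<le> 1" using d L.chi_gt_1 by (simp add: pos_le_divide_eq mult.commute)
  finally have "L.Phi d \<le> 1" .
  have "d \<le> L.Phi d"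
    using L.Phi_above_diagonal[of d y] d t \<open>y \<le> L.Phi y\<close> by simp
  then have "L.reserve_solution L.Phi d" using L.reserve_solution_Phi_iff[OF d(1)] by simp
  moreover have "L.Phi u \<le> 1" if "u \<in> {0<..d}" for u
    using L.Phi_mono[of u d] that \<open>L.Phi d \<le> 1\<close> by auto
  ultimately have "U.reserve_solution L.Phi d" using reserve_solution_eq by blast
  then have "L.Phi d \<le> U.Phi d" using d(1) by (intro U.reserve_solution_le_Phi) auto
  then have "L.Phi d = U.Phi d" using le[of d] d t by simp
  then show ?thesis
    using L.clamped.solves_on_unique[OF d(1) L.reserve_solution_clamped[OF solL d(1)]
        L.reserve_solution_clamped[OF solU d(1)], of d t] d t by simp
qed

lemma ub_domain_bounded:
  assumes "\<not> ub_exceeds_1 f \<tau> \<alpha>"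
  obtains B where "0 < B" "B \<le> 1" "U.Phi B = B" "ub_domain f \<tau> \<alpha> = {0..B}"
proof -
  let ?D = "ub_domain f \<tau> \<alpha>"
  have le1: "U.Phi y \<le> 1" if "y \<in> ?D" for y
    using assms that by (auto simp: ub_exceeds_1_def phi_ub_eq not_less)
  have y1: "y \<le> 1" if "y \<in> ?D" for y
    using le1[OF that] that by (auto simp: ub_domain_eq)
  obtain \<delta> where \<delta>: "0 < \<delta>" "\<delta> \<in> ?D"
    using U.Phi_near_0 by (fastforce simp: ub_domain_eq)
  define B where "B = Sup ?D"
  have bdd: "bdd_above ?D" using y1 by (auto simp: bdd_above_def)
  have upper: "y \<le> B" if "y \<in> ?D" for y unfolding B_def using that bdd by (rule cSup_upper)
  have B: "0 < B" using upper[OF \<delta>(2)] \<delta>(1) by simp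
  have "y \<le> U.Phi B" if y: "y \<in> ?D" for y
  proof (cases "y = 0")
    case True
    then show ?thesis using U.Phi_mono[of \<delta> B] upper[OF \<delta>(2)] \<delta> by (simp add: ub_domain_eq)
  next
    case False
    then show ?thesis using U.Phi_mono[of y B] upper[OF y] y by (simp add: ub_domain_eq)
  qed
  then have "B \<le> U.Phi B" unfolding B_def using \<delta> by (intro cSup_least) auto
  then have BD: "B \<in> ?D" using B by (simp add: ub_domain_eq)
  \<comment> \<open>By monotonicity \<open>U.Phi\<close> maps the domain into itself, so
    \<open>U.Phi B\<close> cannot exceed the supremum \<open>B\<close>: the solution ends exactly on
    the diagonal.\<close>
  have "U.Phi B \<in> ?D"
    using U.Phi_mono[of B "U.Phi B"] B \<open>B \<le> U.Phi B\<close> by (simp add: ub_domain_eq)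
  then have "U.Phi B = B" using upper \<open>B \<le> U.Phi B\<close> by (simp add: antisym)
  moreover have "?D = {0..B}"
    using upper U.Phi_above_diagonal[of _ B] \<open>B \<le> U.Phi B\<close> by (auto simp: ub_domain_eq)
  ultimately show ?thesis using that B y1[OF BD] by blast
qed

text \<open>Strict growth above the diagonal makes the crossing of level 1 unique, and lying
  strictly above the diagonal there places it before time 1.\<close>

lemma y_star_properties:
  assumes "ub_exceeds_1 f \<tau> \<alpha>"
  shows "0 < y_star f \<tau> \<alpha>" "y_star f \<tau> \<alpha> < 1" "U.Phi (y_star f \<tau> \<alpha>) = 1"
proof -
  obtain y where "y \<in> ub_domain f \<tau> \<alpha>" "1 < phi_ub f \<tau> \<alpha> y"
    using assms by (auto simp: ub_exceeds_1_def)
  then have y: "0 \<le> y" "y \<le> U.Phi y" "1 < U.Phi y"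
    by (auto simp: ub_domain_eq phi_ub_eq)
  obtain s where s: "0 \<le> s" "s \<le> y" "U.Phi s = 1"
    using IVT'[of U.Phi 0 1 y] U.continuous_on_Phi[of y] y U.Phi_0 by auto
  have "s \<noteq> 0" "s \<noteq> y" using s y U.Phi_0 by auto
  then have s': "0 < s" "s < y" using s by auto
  have s1: "s < 1" using U.Phi_above_diagonal_strict[OF s' y(2)] s by simp
  have "y_star f \<tau> \<alpha> = s"
    unfolding y_star_def
  proof (rule the_equality)
    have sD: "s \<in> ub_domain f \<tau> \<alpha>" using s s1 by (simp add: ub_domain_eq)
    then show "s \<in> ub_domain f \<tau> \<alpha> \<and> phi_ub f \<tau> \<alpha> s = 1" by (simp add: phi_ub_eq s(3))
    fix r assume "r \<in> ub_domain f \<tau> \<alpha> \<and> phi_ub f \<tau> \<alpha> r = 1"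
    then have r: "0 \<le> r" "r \<le> U.Phi r" "U.Phi r = 1"
      using phi_ub_eq[of r] by (auto simp: ub_domain_eq)
    moreover have "r \<noteq> 0" using r U.Phi_0 by auto
    ultimately show "r = s"
      using U.Phi_strict_mono[of r s] U.Phi_strict_mono[of s r] s s1 s'
      by (cases r s rule: linorder_cases) auto
  qed
  then show "0 < y_star f \<tau> \<alpha>" "y_star f \<tau> \<alpha> < 1" "U.Phi (y_star f \<tau> \<alpha>) = 1"
    using s' s1 s by auto
qed

text \<open>After \<open>y_star\<close>, monotonicity keeps \<open>L.Phi\<close> at least 1 and
  hence above the diagonal up to time 1. Clamping is inactive there, so \<open>L.Phi\<close> is a
  continuation, the only one by \<open>positive_solution_le\<close>.\<close>

lemma phi_ext_exceeding:
  assumes ex: "ub_exceeds_1 f \<tau> \<alpha>" and y: "0 \<le> y" "y \<le> 1"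
  shows "y \<in> phi_ext_domain f \<tau> \<alpha>" "phi_ext f \<tau> \<alpha> y = L.Phi y" "y \<le> L.Phi y"
proof -
  define s where "s = y_star f \<tau> \<alpha>"
  have s: "0 < s" "s < 1" "U.Phi s = 1" using y_star_properties[OF ex] by (auto simp: s_def)
  have Ls: "L.Phi s = 1" using Phi_agree[of s s] s by simp
  have Lge: "1 \<le> L.Phi t" if "s \<le> t" for t using L.Phi_mono[of s t] that s Ls by simp
  have "y \<in> phi_ext_domain f \<tau> \<alpha> \<and> phi_ext f \<tau> \<alpha> y = L.Phi y \<and> y \<le> L.Phi y"
  proof (cases "y \<le> s")
    case True
    have "y \<le> U.Phi y" using U.Phi_above_diagonal[of y s] True y s by simp
    then have "phi_ub f \<tau> \<alpha> y = U.Phi y" using y by (intro phi_ub_eq) (simp add: ub_domain_eq)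
    moreover have "L.Phi y = U.Phi y" using Phi_agree[of s y] True y s by simp
    ultimately show ?thesis
      using True y ex \<open>y \<le> U.Phi y\<close> by (simp add: phi_ext_domain_def phi_ext_def s_def)
  next
    case False
    have Lcont: "0 < L.Phi u \<and> (L.Phi has_real_derivative L.field u (L.Phi u)) (at u within {s..y})"
      if u: "u \<in> {s..y}" for u
    proof -
      have "1 \<le> L.Phi u" "0 < u" "u \<le> 1" using Lge[of u] u s y by auto
      then show ?thesis using L.Phi_deriv[of u "{s..y}"] by (simp add: L.clamped_eq)
    qed
    have L: "continuation f \<alpha> s y L.Phi"
      unfolding continuation_def
    proof (intro conjI ballI)
      fix u assume u: "u \<in> {s..y}"
      show "0 < L.Phi u" using Lcont[OF u] by simp
      then show "(L.Phi has_real_derivative limited_rhs f \<alpha> u (L.Phi u)) (at u within {s..y})"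
        using Lcont[OF u] by (simp add: limited_rhs_eq)
    qed (use Ls False in simp_all)
    have "\<phi> y = L.Phi y" if "continuation f \<alpha> s y \<phi>" for \<phi>
    proof (rule antisym)
      have cont: "0 < \<phi> u \<and> (\<phi> has_real_derivative L.field u (\<phi> u)) (at u within {s..y})"
        if u: "u \<in> {s..y}" for u
      proof -
        have "0 < \<phi> u" "(\<phi> has_real_derivative limited_rhs f \<alpha> u (\<phi> u)) (at u within {s..y})"
          using \<open>continuation f \<alpha> s y \<phi>\<close> u by (simp_all add: continuation_def)
        then show ?thesis by (simp add: limited_rhs_eq)
      qed
      have init: "\<phi> s = L.Phi s" using that Ls by (simp add: continuation_def)
      have sy: "s \<le> y" using False by simp
      show "\<phi> y \<le> L.Phi y"
        by (rule L.positive_solution_le[OF s(1) sy cont Lcont]) (simp_all add: init)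
      show "L.Phi y \<le> \<phi> y"
        by (rule L.positive_solution_le[OF s(1) sy Lcont cont]) (simp_all add: init)
    qed
    then have "(THE v. \<exists>\<phi>. continuation f \<alpha> s y \<phi> \<and> \<phi> y = v) = L.Phi y"
      using L by (intro the_equality) blast+
    then have "phi_ext f \<tau> \<alpha> y = L.Phi y"
      using False ex by (simp add: phi_ext_def s_def)
    moreover have "y \<in> phi_ext_domain f \<tau> \<alpha>"
      using ex L unfolding phi_ext_domain_def s_def by auto
    moreover have "y \<le> L.Phi y" using Lge[of y] False y by simp
    ultimately show ?thesis by simp
  qed
  then show "y \<in> phi_ext_domain f \<tau> \<alpha>" "phi_ext f \<tau> \<alpha> y = L.Phi y" "y \<le> L.Phi y" by auto
qed

text \<open>\<open>B\<close> is the last time in the unit interval at which the extended solution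
  exists. The alternative that either \<open>B\<close> is 1 or the solution meets the diagonal at
  \<open>B\<close> decides all three cases.\<close>

lemma utilization_range:
  obtains B where "0 < B" "B \<le> 1" "B \<le> L.Phi B" "B = 1 \<or> L.Phi B = B"
    "{0..1} \<inter> phi_ext_domain f \<tau> \<alpha> = {0..B}"
    "\<forall>y\<in>{0..B}. phi_ext f \<tau> \<alpha> y = L.Phi y"
    "max_utilization f \<tau> \<alpha> = L.Phi B"
proof -
  have "\<exists>B. 0 < B \<and> B \<le> 1 \<and> B \<le> L.Phi B \<and> (B = 1 \<or> L.Phi B = B) \<and>
    {0..1} \<inter> phi_ext_domain f \<tau> \<alpha> = {0..B} \<and> (\<forall>y\<in>{0..B}. phi_ext f \<tau> \<alpha> y = L.Phi y)"
  proof (cases "ub_exceeds_1 f \<tau> \<alpha>")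
    case True
    then show ?thesis
      using phi_ext_exceeding[OF True] by (intro exI[of _ 1]) auto
  next
    case False
    then obtain B where B: "0 < B" "B \<le> 1" "U.Phi B = B" "ub_domain f \<tau> \<alpha> = {0..B}"
      using ub_domain_bounded by blast
    have agree: "L.Phi t = U.Phi t" if "0 \<le> t" "t \<le> B" for t
      using Phi_agree[of B t] B that by simp
    have "phi_ext f \<tau> \<alpha> y = L.Phi y" if "0 \<le> y" "y \<le> B" for y
      using False phi_ub_eq[of y] B agree[OF that] that by (simp add: phi_ext_def)
    moreover have "{0..1} \<inter> phi_ext_domain f \<tau> \<alpha> = {0..B}"
      using False B by (auto simp: phi_ext_domain_def)
    ultimately show ?thesis
      using B agree[of B] by (intro exI[of _ B]) auto
  qed
  then obtain B where B: "0 < B" "B \<le> 1" "B \<le> L.Phi B" "B = 1 \<or> L.Phi B = B"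
    "{0..1} \<inter> phi_ext_domain f \<tau> \<alpha> = {0..B}"
    "\<forall>y\<in>{0..B}. phi_ext f \<tau> \<alpha> y = L.Phi y" by blast
  have "max_utilization f \<tau> \<alpha> = L.Phi B"
    unfolding max_utilization_def B(5)
  proof (rule cSup_eq_maximum)
    show "L.Phi B \<in> phi_ext f \<tau> \<alpha> ` {0..B}"
      by (rule image_eqI[of _ _ B]) (use B(1) B(6) in auto)
    fix v assume "v \<in> phi_ext f \<tau> \<alpha> ` {0..B}"
    then obtain y where y: "0 \<le> y" "y \<le> B" "v = L.Phi y" using B(6) by auto
    then show "v \<le> L.Phi B"
      using L.Phi_mono[of y B] L.Phi_0 B by (cases "y = 0") auto
  qed
  then show ?thesis using that B by blast
qed

section \<open>The three cases of (LS)\<close>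

lemma LS_solutions_iff:
  assumes "0 < \<rho>"
  shows "\<phi> \<in> LS_solutions f \<alpha> \<rho> \<longleftrightarrow>
    \<phi> \<in> extensional {0..min \<rho> 1} \<and> L.reserve_solution \<phi> (min \<rho> 1) \<and> \<rho> \<le> \<phi> (min \<rho> 1)"
    (is "_ \<longleftrightarrow> ?E \<and> ?S \<and> ?T")
proof -
  let ?b = "min \<rho> 1"
  \<comment> \<open>From \<open>0 < y \<le> \<phi> y\<close> the value is positive, which identifies
    the two right-hand sides, and \<open>field_nonneg\<close> supplies the sign of the
    derivative.\<close>
  have eq: "(y \<le> \<phi> y \<and> (\<exists>D. (\<phi> has_real_derivative D) (at y within {0..?b}) \<and>
        D = limited_rhs f \<alpha> y (\<phi> y) \<and> 0 \<le> D)) \<longleftrightarrow>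
      (y \<le> \<phi> y \<and> (\<phi> has_real_derivative L.field y (\<phi> y)) (at y within {0..?b}))"
    if "y \<in> {0<..?b}" for y
    using that limited_rhs_eq[of "\<phi> y" y] L.field_nonneg[of y "\<phi> y"] by auto
  have "?S \<Longrightarrow> u \<in> {0..?b} \<Longrightarrow> 0 \<le> \<phi> u" for u
    by (cases "u = 0") (auto simp: L.reserve_solution_def intro: order_trans[of 0 u])
  then show ?thesis
    unfolding LS_solutions_def Let_def mem_Collect_eq PiE_iff L.reserve_solution_def
    using eq by (auto cong: ball_cong)
qed

text \<open>A solution would lie below \<open>L.Phi\<close>. If \<open>B\<close> is 1, its end value
  is then at most the maximal utilization. Otherwise \<open>L.Phi\<close> meets the diagonal at
  \<open>B\<close>, although a solution reaching beyond \<open>B\<close> forces it strictly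
  above.\<close>

lemma LS_solutions_empty:
  assumes rho: "0 < \<rho>" "max_utilization f \<tau> \<alpha> < \<rho>"
  shows "LS_solutions f \<alpha> \<rho> = {}"
proof (rule ccontr)
  assume "LS_solutions f \<alpha> \<rho> \<noteq> {}"
  then obtain \<phi> where "\<phi> \<in> LS_solutions f \<alpha> \<rho>" by blast
  then have sol: "L.reserve_solution \<phi> (min \<rho> 1)" "\<rho> \<le> \<phi> (min \<rho> 1)"
    by (simp_all add: LS_solutions_iff[OF rho(1)])
  obtain B where B: "0 < B" "B \<le> 1" "B \<le> L.Phi B" "B = 1 \<or> L.Phi B = B"
    "{0..1} \<inter> phi_ext_domain f \<tau> \<alpha> = {0..B}"
    "\<forall>y\<in>{0..B}. phi_ext f \<tau> \<alpha> y = L.Phi y"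
    "max_utilization f \<tau> \<alpha> = L.Phi B"
    by (rule utilization_range)
  have b: "0 < min \<rho> 1" using rho by simp
  have ge: "min \<rho> 1 \<le> L.Phi (min \<rho> 1)" using L.reserve_solution_imp_Phi[OF sol(1) b] .
  have le: "\<rho> \<le> L.Phi (min \<rho> 1)"
    using L.reserve_solution_le_Phi[OF sol(1), of "min \<rho> 1"] b sol(2) by simp
  have "B < \<rho>" using B(3,7) rho(2) by linarith
  show False
  proof (cases "B = 1")
    case True
    then have "min \<rho> 1 = 1" using B(7) rho(2) \<open>B < \<rho>\<close> by simp
    then show ?thesis using le B(7) rho(2) True by simp
  next
    case False
    then have "B < min \<rho> 1" using B(2) \<open>B < \<rho>\<close> by simp
    then have "B < L.Phi B" using L.Phi_above_diagonal_strict[OF B(1) _ ge] by simp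
    then show ?thesis using B(4) False by simp
  qed
qed

text \<open>The end value is pinned between the required \<open>\<rho>\<close> and the maximal value
  \<open>L.Phi B\<close>, which are equal. Uniqueness is then read backwards from \<open>B\<close>,
  the initial condition at \<open>0\<close> being too weak for it.\<close>

lemma LS_solutions_unique:
  assumes rho: "0 < \<rho>" "\<rho> = max_utilization f \<tau> \<alpha>"
  shows "{0..min \<rho> 1} \<subseteq> phi_ext_domain f \<tau> \<alpha>"
    and "LS_solutions f \<alpha> \<rho> = {restrict (phi_ext f \<tau> \<alpha>) {0..min \<rho> 1}}"
proof -
  obtain B where B: "0 < B" "B \<le> 1" "B \<le> L.Phi B" "B = 1 \<or> L.Phi B = B"
    and dom: "{0..1} \<inter> phi_ext_domain f \<tau> \<alpha> = {0..B}"
    and ext: "\<forall>y\<in>{0..B}. phi_ext f \<tau> \<alpha> y = L.Phi y"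
    and P: "max_utilization f \<tau> \<alpha> = L.Phi B"
    by (rule utilization_range)
  have b: "min \<rho> 1 = B" using B(2,3,4) P rho(2) by linarith
  show "{0..min \<rho> 1} \<subseteq> phi_ext_domain f \<tau> \<alpha>" using dom b by auto
  have solPhi: "L.reserve_solution L.Phi B" using L.reserve_solution_Phi_iff[OF B(1)] B by simp
  then have "L.reserve_solution (restrict (phi_ext f \<tau> \<alpha>) {0..B}) B"
    by (rule L.reserve_solution_cong[OF _ B(1)]) (simp add: ext)
  then have "restrict (phi_ext f \<tau> \<alpha>) {0..min \<rho> 1} \<in> LS_solutions f \<alpha> \<rho>"
    unfolding LS_solutions_iff[OF rho(1)] b using B ext rho P by simp
  moreover have "\<phi> = restrict (phi_ext f \<tau> \<alpha>) {0..min \<rho> 1}" if "\<phi> \<in> LS_solutions f \<alpha> \<rho>" for \<phi>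
  proof (rule extensionalityI)
    have \<phi>: "\<phi> \<in> extensional {0..B}" "L.reserve_solution \<phi> B" "\<rho> \<le> \<phi> B"
      using that unfolding LS_solutions_iff[OF rho(1)] b by auto
    show "\<phi> \<in> extensional {0..B}" by fact
    show "restrict (phi_ext f \<tau> \<alpha>) {0..min \<rho> 1} \<in> extensional {0..B}" unfolding b by simp
    have "\<phi> B \<le> L.Phi B" using L.reserve_solution_le_Phi[OF \<phi>(2), of B] B by simp
    then have end_eq: "\<phi> B = L.Phi B" using \<phi>(3) rho P by simp
    fix u assume u: "u \<in> {0..B}"
    have "\<phi> u = L.Phi u"
    proof (cases "u = 0")
      case True
      then show ?thesis using \<phi>(2) by (simp add: L.reserve_solution_def L.Phi_0)
    next
      case False
      then have "0 < u" using u by simp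
      from L.clamped.solves_on_unique[OF this L.reserve_solution_clamped[OF \<phi>(2) this]
          L.reserve_solution_clamped[OF solPhi this], of B u] end_eq u
      show ?thesis by simp
    qed
    then show "\<phi> u = restrict (phi_ext f \<tau> \<alpha>) {0..min \<rho> 1} u" using u ext by (simp add: b)
  qed
  ultimately show "LS_solutions f \<alpha> \<rho> = {restrict (phi_ext f \<tau> \<alpha>) {0..min \<rho> 1}}" by blast
qed

lemma LS_solutions_infinite:
  assumes rho: "0 < \<rho>" "\<rho> < max_utilization f \<tau> \<alpha>"
  shows "infinite (LS_solutions f \<alpha> \<rho>)"
proof -
  define b where "b = min \<rho> 1"
  have b: "0 < b" "b \<le> \<rho>" using rho by (auto simp: b_def)
  obtain B where B: "0 < B" "B \<le> 1" "B \<le> L.Phi B" "B = 1 \<or> L.Phi B = B"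
    "{0..1} \<inter> phi_ext_domain f \<tau> \<alpha> = {0..B}"
    "\<forall>y\<in>{0..B}. phi_ext f \<tau> \<alpha> y = L.Phi y"
    and P: "max_utilization f \<tau> \<alpha> = L.Phi B"
    by (rule utilization_range)
  \<comment> \<open>Before \<open>B\<close> the end point is \<open>\<rho>\<close> itself and
    \<open>L.Phi\<close> lies strictly above the diagonal; otherwise the end point is
    \<open>B\<close> and the gap is the hypothesis on \<open>\<rho>\<close>.\<close>
  have lt: "\<rho> < L.Phi b"
  proof (cases "b < B")
    case True
    then have "b = \<rho>" using B(2) unfolding b_def by linarith
    then show ?thesis using L.Phi_above_diagonal_strict[OF b(1) True B(3)] by simp
  next
    case False
    then have "b = B" using B(2,4) rho(2) P unfolding b_def by linarith
    then show ?thesis using rho P by simp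
  qed
  have "\<exists>x. x b = v \<and> L.clamped_solution x" for v
    using L.clamped.exists_solution[OF b(1), of v] by blast
  then obtain X where X: "\<And>v. X v b = v" "\<And>v. L.clamped_solution (X v)" by metis
  define S where "S v = restrict (\<lambda>u. if u = 0 then 0 else X v u) {0..b}" for v
  have Sb: "S v b = v" for v using X(1)[of v] b by (simp add: S_def)
  have "S ` {\<rho>..L.Phi b} \<subseteq> LS_solutions f \<alpha> \<rho>"
  proof
    fix \<phi> assume "\<phi> \<in> S ` {\<rho>..L.Phi b}"
    then obtain v where v: "\<rho> \<le> v" "v \<le> L.Phi b" and \<phi>: "\<phi> = S v" by auto
    have "L.reserve_solution (\<lambda>u. if u = 0 then 0 else X v u) b"
      using X v b by (intro L.reserve_solution_below_Phi) auto
    then have "L.reserve_solution (S v) b"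
      by (rule L.reserve_solution_cong[OF _ b(1)]) (simp add: S_def)
    then show "\<phi> \<in> LS_solutions f \<alpha> \<rho>"
      unfolding LS_solutions_iff[OF rho(1)] b_def[symmetric] \<phi>
      using v Sb by (simp add: S_def)
  qed
  moreover have "inj_on S {\<rho>..L.Phi b}" by (rule inj_onI) (metis Sb)
  then have "infinite (S ` {\<rho>..L.Phi b})"
    using lt by (simp add: finite_image_iff infinite_Icc)
  ultimately show ?thesis using finite_subset by blast
qed

end

theorem theorem6:
  fixes \<tau> \<sigma> :: nat and f :: "real poly" and \<alpha> \<rho> :: real
  assumes "2 \<le> \<tau>" and "\<tau> \<le> \<sigma>"
    and "cost_polynomial \<tau> \<sigma> f"
    and "alpha_star \<tau> \<le> \<alpha>"
    and "0 < \<rho>"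
  shows "(max_utilization f \<tau> \<alpha> < \<rho> \<longrightarrow> LS_solutions f \<alpha> \<rho> = {}) \<and>
         (\<rho> = max_utilization f \<tau> \<alpha> \<longrightarrow>
            {0..min \<rho> 1} \<subseteq> phi_ext_domain f \<tau> \<alpha> \<and>
            LS_solutions f \<alpha> \<rho> = {restrict (phi_ext f \<tau> \<alpha>) {0..min \<rho> 1}}) \<and>
         (\<rho> < max_utilization f \<tau> \<alpha> \<longrightarrow> infinite (LS_solutions f \<alpha> \<rho>))"
proof -
  obtain c where c: "f = (\<Sum>k=\<tau>..\<sigma>. monom (c k) k)" "\<forall>k\<in>{\<tau>..\<sigma>}. 0 \<le> c k" "0 < c \<tau>"
    using assms(3) unfolding cost_polynomial_def by blast
  interpret cost_function \<tau> \<sigma> c \<alpha> f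
    by unfold_locales (use assms c in auto)
  show ?thesis
    using LS_solutions_empty[OF assms(5)] LS_solutions_unique[OF assms(5)]
      LS_solutions_infinite[OF assms(5)] by blast
qed

end
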